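(* Let $G$ be a Lie group with finitely many connected components and $\rho:G\to\mathrm{Diff}[[\mathbb{C}^n,0]]$ an injective homomorphism of Lie groups. Then there exists $p\in\mathbb{N}$ such that for any $g_1,g_2\in G$, $j^p\rho(g_1)=j^p\rho(g_2)$ if and only if $g_1=g_2$.
   Context: $\mathrm{Diff}[[\mathbb{C}^n,0]]$ is the group of $\mathbb{C}$-algebra automorphisms of $\mathbb{C}[[x_1,\dots,x_n]]$ preserving the maximal ideal $\mathfrak m$; $j^p$ denotes the induced automorphism of the jet ring $\mathbb{C}[[x]]/\mathfrak m^{p+1}$ (the $p$-jet). A homomorphism of Lie groups into $\mathrm{Diff}[[\mathbb{C}^n,0]]$ means that for every $p$ the induced map into the finite-dimensional group of $p$-jets is a homomorphism of Lie groups. *)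

theory Defs
  imports "HOL-Analysis.Analysis" "HOL-Algebra.Group"
begin

fun Ck_on :: "nat \<Rightarrow> 'a::euclidean_space set \<Rightarrow> ('a \<Rightarrow> 'b::real_normed_vector) \<Rightarrow> bool" where
  "Ck_on 0 S f = continuous_on S f"
| "Ck_on (Suc k) S f =
     (f differentiable_on S \<and>
      (\<forall>b\<in>Basis. Ck_on k S (\<lambda>x. frechet_derivative f (at x) b)))"

definition smooth_on :: "'a::euclidean_space set \<Rightarrow> ('a \<Rightarrow> 'b::real_normed_vector) \<Rightarrow> bool" where
  "smooth_on S f \<longleftrightarrow> (\<forall>k. Ck_on k S f)"

text \<open>A Lie group: a group G (HOL-Algebra), a Hausdorff topology T on its carrier,
  and either T is discrete (dimension 0, no charts needed) or A is a smooth atlas of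
  charts (U, phi) with values in the euclidean space 'e (dimension DIM('e) >= 1)
  for which multiplication and inversion are smooth.\<close>

definition lie_group ::
  "('g, 'm) monoid_scheme \<Rightarrow> 'g topology \<Rightarrow> ('g set \<times> ('g \<Rightarrow> 'e::euclidean_space)) set \<Rightarrow> bool" where
  "lie_group G T A \<longleftrightarrow>
     group G \<and> topspace T = carrier G \<and> Hausdorff_space T \<and>
     continuous_map (prod_topology T T) T (\<lambda>(x, y). x \<otimes>\<^bsub>G\<^esub> y) \<and>
     continuous_map T T (\<lambda>x. inv\<^bsub>G\<^esub> x) \<and>
     ((T = discrete_topology (carrier G) \<and> A = {}) \<or>
      ((\<forall>(U, \<phi>)\<in>A. openin T U \<and> open (\<phi> ` U) \<and>
            homeomorphic_map (subtopology T U) (top_of_set (\<phi> ` U)) \<phi>) \<and>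
       (\<Union>(fst ` A) = carrier G) \<and>
       (\<forall>(U, \<phi>)\<in>A. \<forall>(V, \<psi>)\<in>A.
            smooth_on (\<phi> ` (U \<inter> V)) (\<lambda>a. \<psi> (inv_into U \<phi> a))) \<and>
       (\<forall>(U, \<phi>)\<in>A. \<forall>(V, \<psi>)\<in>A. \<forall>(W, \<theta>)\<in>A.
            smooth_on {(a, b). a \<in> \<phi> ` U \<and> b \<in> \<psi> ` V \<and>
                               inv_into U \<phi> a \<otimes>\<^bsub>G\<^esub> inv_into V \<psi> b \<in> W}
                      (\<lambda>(a, b). \<theta> (inv_into U \<phi> a \<otimes>\<^bsub>G\<^esub> inv_into V \<psi> b))) \<and>
       (\<forall>(U, \<phi>)\<in>A. \<forall>(V, \<psi>)\<in>A.
            smooth_on {a \<in> \<phi> ` U. inv\<^bsub>G\<^esub> (inv_into U \<phi> a) \<in> V}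
                      (\<lambda>a. \<psi> (inv\<^bsub>G\<^esub> (inv_into U \<phi> a))))))"

text \<open>A series is a coefficient function on multi-indices alpha :: nat => nat;
  only multi-indices supported in {0..<n} are allowed.\<close>

type_synonym mser = "(nat \<Rightarrow> nat) \<Rightarrow> complex"

definition mi :: "nat \<Rightarrow> (nat \<Rightarrow> nat) set" where
  "mi n = {\<alpha>. \<forall>i\<ge>n. \<alpha> i = 0}"

definition mdeg :: "nat \<Rightarrow> (nat \<Rightarrow> nat) \<Rightarrow> nat" where
  "mdeg n \<alpha> = (\<Sum>i<n. \<alpha> i)"

definition PS :: "nat \<Rightarrow> mser set" where
  "PS n = {f. \<forall>\<alpha>. \<alpha> \<notin> mi n \<longrightarrow> f \<alpha> = 0}"

definition ps_add :: "mser \<Rightarrow> mser \<Rightarrow> mser" where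
  "ps_add f g = (\<lambda>\<alpha>. f \<alpha> + g \<alpha>)"

definition ps_scale :: "complex \<Rightarrow> mser \<Rightarrow> mser" where
  "ps_scale c f = (\<lambda>\<alpha>. c * f \<alpha>)"

definition ps_one :: mser where
  "ps_one = (\<lambda>\<alpha>. if \<alpha> = (\<lambda>_. 0) then 1 else 0)"

definition ps_mult :: "mser \<Rightarrow> mser \<Rightarrow> mser" where
  "ps_mult f g = (\<lambda>\<alpha>. \<Sum>\<beta>\<in>{\<beta>. \<forall>i. \<beta> i \<le> \<alpha> i}. f \<beta> * g (\<lambda>i. \<alpha> i - \<beta> i))"

definition ps_var :: "nat \<Rightarrow> mser" where
  "ps_var i = (\<lambda>\<alpha>. if \<alpha> = (\<lambda>j. if j = i then 1 else 0) then 1 else 0)"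

definition max_ideal :: "nat \<Rightarrow> mser set" where
  "max_ideal n = {f \<in> PS n. f (\<lambda>_. 0) = 0}"

text \<open>Diff[[C^n,0]]: C-algebra automorphisms of C[[x_1..x_n]] preserving m.
  Convention: an automorphism is extended by the identity outside PS n, so that the
  group law is composition of functions.\<close>
definition Diff :: "nat \<Rightarrow> (mser \<Rightarrow> mser) set" where
  "Diff n = {\<Phi>. bij_betw \<Phi> (PS n) (PS n) \<and>
     (\<forall>f\<in>PS n. \<forall>g\<in>PS n. \<Phi> (ps_add f g) = ps_add (\<Phi> f) (\<Phi> g) \<and>
                         \<Phi> (ps_mult f g) = ps_mult (\<Phi> f) (\<Phi> g)) \<and>
     (\<forall>c. \<forall>f\<in>PS n. \<Phi> (ps_scale c f) = ps_scale c (\<Phi> f)) \<and>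
     \<Phi> ps_one = ps_one \<and>
     \<Phi> ` max_ideal n = max_ideal n \<and>
     (\<forall>f. f \<notin> PS n \<longrightarrow> \<Phi> f = f)}"

text \<open>p-jets: C[[x]]/m^(p+1) is represented by series with no coefficients of degree
  > p (truncations); j^p Phi [f] = [Phi f].  Extended by the identity elsewhere.\<close>
definition trunc :: "nat \<Rightarrow> nat \<Rightarrow> mser \<Rightarrow> mser" where
  "trunc n p f = (\<lambda>\<alpha>. if mdeg n \<alpha> \<le> p then f \<alpha> else 0)"

definition jet_space :: "nat \<Rightarrow> nat \<Rightarrow> mser set" where
  "jet_space n p = {f \<in> PS n. \<forall>\<alpha>. p < mdeg n \<alpha> \<longrightarrow> f \<alpha> = 0}"

definition jet :: "nat \<Rightarrow> nat \<Rightarrow> (mser \<Rightarrow> mser) \<Rightarrow> (mser \<Rightarrow> mser)" where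
  "jet n p \<Phi> = (\<lambda>t. if t \<in> jet_space n p then trunc n p (\<Phi> t) else t)"

text \<open>rho is a group homomorphism into Diff, and for every p the induced map to p-jets is
  smooth; the p-jet group carries the global coordinates given by the coefficients of
  degree <= p of j^p Phi (x_i), i < n.\<close>
definition lie_hom_Diff ::
  "('g, 'm) monoid_scheme \<Rightarrow> ('g set \<times> ('g \<Rightarrow> 'e::euclidean_space)) set \<Rightarrow> nat \<Rightarrow>
   ('g \<Rightarrow> mser \<Rightarrow> mser) \<Rightarrow> bool" where
  "lie_hom_Diff G A n \<rho> \<longleftrightarrow>
     (\<forall>g\<in>carrier G. \<rho> g \<in> Diff n) \<and>
     (\<forall>g\<in>carrier G. \<forall>h\<in>carrier G. \<rho> (g \<otimes>\<^bsub>G\<^esub> h) = \<rho> g \<circ> \<rho> h) \<and>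
     (\<forall>p. \<forall>(U, \<phi>)\<in>A. \<forall>i<n. \<forall>\<alpha>\<in>mi n. mdeg n \<alpha> \<le> p \<longrightarrow>
         smooth_on (\<phi> ` U) (\<lambda>a. jet n p (\<rho> (inv_into U \<phi> a)) (ps_var i) \<alpha>))"

end

theory Submission
  imports Defs
begin

text \<open>Let \<open>K p\<close> be the subgroup of elements acting trivially on \<open>p\<close>-jets; these normal
  subgroups decrease and intersect in the unit.

  Left translations act linearly on jets, so the kernel of the derivative of the \<open>p\<close>-jet map has constant
  dimension, and it is the same for all large \<open>p\<close>. A curve tangent to it would have constant jets of all
  orders, contradicting injectivity; hence \<open>K p\<close> is discrete for some \<open>p\<close> and
  commutes with the identity component.

  Suppose \<open>K q \<noteq> K (q + 1)\<close> inside the identity component for more than \<open>dim G\<close> values \<open>q\<^sub>j\<close>, witnessed by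
  \<open>d\<^sub>j\<close>. The coefficients of degree \<open>q\<^sub>j + 1\<close>, normalised by the linear action, give
  smooth \<open>f\<^sub>j\<close> on \<open>G\<close> with \<open>f\<^sub>j (g d\<^sub>j) = f\<^sub>j g + 1\<close> and \<open>f\<^sub>j (g d\<^sub>i) = f\<^sub>j g\<close> for \<open>i > j\<close>. Multiplying
  quasi-periodic paths through the powers of the \<open>d\<^sub>j\<close> gives a map from Euclidean space of
  dimension \<open>dim G + 1\<close> to \<open>G\<close> whose composite with \<open>(f\<^sub>j)\<close> covers a cube by Brouwer's theorem, whereas a
  smooth image of a manifold of smaller dimension is negligible. So \<open>K q\<close> meets the identity component
  trivially for some \<open>q\<close>; it then embeds into the finite set of components, and a further increase of \<open>q\<close>
  makes it trivial.\<close>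

subsection \<open>Formal power series and their automorphisms\<close>

text \<open>Equality of \<open>p\<close>-jets. For members of \<open>PS n\<close> this is congruence
  modulo the power \<open>p + 1\<close> of the maximal ideal, and
  \<open>agree n p f (\<lambda>_. 0)\<close> says that \<open>f\<close> lies in that power. Working
  with coefficients avoids quotient rings.\<close>

definition agree :: "nat \<Rightarrow> nat \<Rightarrow> mser \<Rightarrow> mser \<Rightarrow> bool" where
  "agree n p f g \<longleftrightarrow> (\<forall>\<alpha>\<in>mi n. mdeg n \<alpha> \<le> p \<longrightarrow> f \<alpha> = g \<alpha>)"

definition ps_mono :: "(nat \<Rightarrow> nat) \<Rightarrow> mser" where
  "ps_mono \<beta> = (\<lambda>\<alpha>. if \<alpha> = \<beta> then 1 else 0)"

definition ps_hom :: "nat \<Rightarrow> nat \<Rightarrow> mser \<Rightarrow> mser" where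
  "ps_hom n q f = (\<lambda>\<alpha>. if mdeg n \<alpha> = q then f \<alpha> else 0)"

definition mi_le :: "nat \<Rightarrow> nat \<Rightarrow> (nat \<Rightarrow> nat) set" where
  "mi_le n p = {\<alpha> \<in> mi n. mdeg n \<alpha> \<le> p}"

lemma agree_refl [simp]: "agree n p f f"
  and agree_sym: "agree n p f g \<Longrightarrow> agree n p g f"
  and agree_trans: "agree n p f g \<Longrightarrow> agree n p g h \<Longrightarrow> agree n p f h"
  and agree_mono: "agree n p f g \<Longrightarrow> q \<le> p \<Longrightarrow> agree n q f g"
  by (auto simp: agree_def)

lemma agree_sum:
  "(\<And>i. i \<in> I \<Longrightarrow> agree n p (F i) (H i)) \<Longrightarrow>
    agree n p (\<lambda>\<alpha>. \<Sum>i\<in>I. F i \<alpha>) (\<lambda>\<alpha>. \<Sum>i\<in>I. H i \<alpha>)"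
  by (auto simp: agree_def intro!: sum.cong)

lemma agree_add:
  "agree n p f f' \<Longrightarrow> agree n p g g' \<Longrightarrow> agree n p (ps_add f g) (ps_add f' g')"
  by (auto simp: agree_def ps_add_def)

lemma finite_mi_le: "finite (mi_le n p)"
proof (rule finite_subset)
  have "\<alpha> i \<le> p" if "\<alpha> \<in> mi_le n p" "i < n" for \<alpha> i
  proof -
    have "\<alpha> i \<le> (\<Sum>i<n. \<alpha> i)" using that by (intro member_le_sum) auto
    then show ?thesis using that by (auto simp: mi_le_def mdeg_def)
  qed
  then show "mi_le n p \<subseteq>
      {\<alpha>. \<forall>i. (i \<in> {..<n} \<longrightarrow> \<alpha> i \<in> {..p}) \<and> (i \<notin> {..<n} \<longrightarrow> \<alpha> i = 0)}"
    by (auto simp: mi_le_def mi_def)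
  show "finite {\<alpha>. \<forall>i. (i \<in> {..<n} \<longrightarrow> \<alpha> i \<in> {..p}) \<and> (i \<notin> {..<n} \<longrightarrow> \<alpha> i = (0::nat))}"
    by (rule finite_set_of_finite_funs) auto
qed

lemma mdeg_eq_0: "\<alpha> \<in> mi n \<Longrightarrow> mdeg n \<alpha> = 0 \<longleftrightarrow> \<alpha> = (\<lambda>_. 0)"
  by (auto simp: mdeg_def mi_def fun_eq_iff) (metis lessThan_iff not_less)

lemma mdeg_diff: "(\<And>i::nat. \<beta> i \<le> \<alpha> i) \<Longrightarrow> mdeg n \<beta> + mdeg n (\<lambda>i. \<alpha> i - \<beta> i) = mdeg n \<alpha>"
  by (auto simp: mdeg_def simp flip: sum.distrib intro!: sum.cong)

lemma mi_diff: "\<alpha> \<in> mi n \<Longrightarrow> (\<And>i. \<beta> i \<le> \<alpha> i) \<Longrightarrow> \<beta> \<in> mi n \<and> (\<lambda>i. \<alpha> i - \<beta> i) \<in> mi n"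
  by (auto simp: mi_def) (metis le_zero_eq)

lemma mdeg_Suc:
  assumes "i < n" shows "mdeg n (\<alpha>(i := Suc (\<alpha> i))) = Suc (mdeg n \<alpha>)"
proof -
  have "mdeg n (\<alpha>(i := Suc (\<alpha> i))) = (\<Sum>j<n. \<alpha> j + (if j = i then 1 else 0))"
    unfolding mdeg_def by (intro sum.cong) auto
  then show ?thesis using assms by (simp add: sum.distrib mdeg_def)
qed

text \<open>In a term of total degree at most \<open>a + b + 1\<close>, either the first factor has
  degree at most \<open>a\<close>, or the second has degree at most \<open>b\<close> and is zero.
  This is the inclusion of the product of the powers \<open>a + 1\<close> and \<open>b + 1\<close>
  of the maximal ideal in the power \<open>a + b + 2\<close>; the extra order drives the inductions
  on the order.\<close>

lemma agree_mult_left: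
  assumes "agree n a f f'" "agree n b g (\<lambda>_. 0)"
  shows "agree n (Suc (a + b)) (ps_mult f g) (ps_mult f' g)"
  unfolding agree_def ps_mult_def
proof (intro ballI impI sum.cong refl)
  fix \<alpha> \<beta> assume \<alpha>: "\<alpha> \<in> mi n" "mdeg n \<alpha> \<le> Suc (a + b)" and "\<beta> \<in> {\<beta>. \<forall>i. \<beta> i \<le> \<alpha> i}"
  then have \<beta>: "\<And>i. \<beta> i \<le> \<alpha> i" by auto
  note * = mdeg_diff[of \<beta> \<alpha> n, OF \<beta>] mi_diff[OF \<alpha>(1) \<beta>]
  show "f \<beta> * g (\<lambda>i. \<alpha> i - \<beta> i) = f' \<beta> * g (\<lambda>i. \<alpha> i - \<beta> i)"
  proof (cases "mdeg n \<beta> \<le> a")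
    case True then show ?thesis using assms(1) * by (auto simp: agree_def)
  next
    case False
    then have "mdeg n (\<lambda>i. \<alpha> i - \<beta> i) \<le> b" using * \<alpha>(2) by linarith
    then show ?thesis using assms(2) * by (auto simp: agree_def)
  qed
qed

lemma agree_mult_right:
  assumes "agree n a f (\<lambda>_. 0)" "agree n b g g'"
  shows "agree n (Suc (a + b)) (ps_mult f g) (ps_mult f g')"
  unfolding agree_def ps_mult_def
proof (intro ballI impI sum.cong refl)
  fix \<alpha> \<beta> assume \<alpha>: "\<alpha> \<in> mi n" "mdeg n \<alpha> \<le> Suc (a + b)" and "\<beta> \<in> {\<beta>. \<forall>i. \<beta> i \<le> \<alpha> i}"
  then have \<beta>: "\<And>i. \<beta> i \<le> \<alpha> i" by auto
  note * = mdeg_diff[of \<beta> \<alpha> n, OF \<beta>] mi_diff[OF \<alpha>(1) \<beta>]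
  show "f \<beta> * g (\<lambda>i. \<alpha> i - \<beta> i) = f \<beta> * g' (\<lambda>i. \<alpha> i - \<beta> i)"
  proof (cases "mdeg n \<beta> \<le> a")
    case True then show ?thesis using assms(1) * by (auto simp: agree_def)
  next
    case False
    then have "mdeg n (\<lambda>i. \<alpha> i - \<beta> i) \<le> b" using * \<alpha>(2) by linarith
    then show ?thesis using assms(2) * by (auto simp: agree_def)
  qed
qed

lemma agree_mult:
  assumes "agree n p f f'" shows "agree n p (ps_mult f g) (ps_mult f' g)"
  unfolding agree_def ps_mult_def
proof (intro ballI impI sum.cong refl)
  fix \<alpha> \<beta> assume \<alpha>: "\<alpha> \<in> mi n" "mdeg n \<alpha> \<le> p" and "\<beta> \<in> {\<beta>. \<forall>i. \<beta> i \<le> \<alpha> i}"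
  then have \<beta>: "\<And>i. \<beta> i \<le> \<alpha> i" by auto
  show "f \<beta> * g (\<lambda>i. \<alpha> i - \<beta> i) = f' \<beta> * g (\<lambda>i. \<alpha> i - \<beta> i)"
    using assms \<alpha> mdeg_diff[of \<beta> \<alpha> n, OF \<beta>] mi_diff[OF \<alpha>(1) \<beta>] by (auto simp: agree_def)
qed

lemma ps_mult_zero [simp]: "ps_mult f (\<lambda>_. 0) = (\<lambda>_. 0)"
  by (simp add: ps_mult_def)

lemma PS_zero [simp]: "(\<lambda>_. 0) \<in> PS n"
  and PS_add: "f \<in> PS n \<Longrightarrow> g \<in> PS n \<Longrightarrow> ps_add f g \<in> PS n"
  and PS_scale: "f \<in> PS n \<Longrightarrow> ps_scale c f \<in> PS n"
  and PS_hom: "f \<in> PS n \<Longrightarrow> ps_hom n q f \<in> PS n"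
  and PS_mono: "\<beta> \<in> mi n \<Longrightarrow> ps_mono \<beta> \<in> PS n"
  and PS_one: "ps_one \<in> PS n"
  and PS_var: "i < n \<Longrightarrow> ps_var i \<in> PS n"
  by (auto simp: PS_def ps_add_def ps_scale_def ps_hom_def ps_mono_def ps_one_def ps_var_def mi_def)

lemma PS_mult: assumes "f \<in> PS n" "g \<in> PS n" shows "ps_mult f g \<in> PS n"
  unfolding PS_def
proof safe
  fix \<alpha> assume a: "\<alpha> \<notin> mi n"
  have "f \<beta> * g (\<lambda>i. \<alpha> i - \<beta> i) = 0" if "\<forall>i. \<beta> i \<le> \<alpha> i" for \<beta>
  proof (cases "\<beta> \<in> mi n")
    case True
    then have "(\<lambda>i. \<alpha> i - \<beta> i) \<notin> mi n" using a by (auto simp: mi_def)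
    then show ?thesis using assms by (auto simp: PS_def)
  qed (use assms in \<open>auto simp: PS_def\<close>)
  then show "ps_mult f g \<alpha> = 0" unfolding ps_mult_def by (intro sum.neutral) auto
qed

lemma PS_sum: "(\<And>i. i \<in> I \<Longrightarrow> F i \<in> PS n) \<Longrightarrow> (\<lambda>\<alpha>. \<Sum>i\<in>I. F i \<alpha>) \<in> PS n"
  by (auto simp: PS_def)

lemma PS_eqI: "f \<in> PS n \<Longrightarrow> g \<in> PS n \<Longrightarrow> (\<And>p. agree n p f g) \<Longrightarrow> f = g"
  by (force simp: PS_def agree_def fun_eq_iff)

lemma max_ideal_iff: "f \<in> max_ideal n \<longleftrightarrow> f \<in> PS n \<and> agree n 0 f (\<lambda>_. 0)"
  by (auto simp: max_ideal_def agree_def mdeg_eq_0) (auto simp: mi_def)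

lemma var_max_ideal: "i < n \<Longrightarrow> ps_var i \<in> max_ideal n"
  by (auto simp: max_ideal_def PS_var) (auto simp: ps_var_def fun_eq_iff)

lemma ps_mult_var:
  assumes "\<alpha> \<in> mi n"
  shows "ps_mult (ps_var i) h \<alpha> = (if \<alpha> i > 0 then h (\<alpha>(i := \<alpha> i - 1)) else 0)"
proof -
  let ?e = "\<lambda>j. if j = i then 1 else (0::nat)"
  have fin: "finite {\<beta>. \<forall>i. \<beta> i \<le> \<alpha> i}"
  proof (rule finite_subset)
    show "{\<beta>. \<forall>i. \<beta> i \<le> \<alpha> i} \<subseteq> mi_le n (mdeg n \<alpha>)"
      using assms by (auto simp: mi_le_def mi_def mdeg_def intro: sum_mono) (metis le_zero_eq)
  qed (rule finite_mi_le)
  have "ps_mult (ps_var i) h \<alpha> =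
      (\<Sum>\<beta>\<in>{\<beta>. \<forall>i. \<beta> i \<le> \<alpha> i}. if \<beta> = ?e then h (\<lambda>j. \<alpha> j - ?e j) else 0)"
    unfolding ps_mult_def ps_var_def by (intro sum.cong) auto
  also have "\<dots> = (if ?e \<in> {\<beta>. \<forall>i. \<beta> i \<le> \<alpha> i} then h (\<lambda>j. \<alpha> j - ?e j) else 0)"
    using fin by (simp add: sum.delta)
  also have "?e \<in> {\<beta>. \<forall>i. \<beta> i \<le> \<alpha> i} \<longleftrightarrow> \<alpha> i > 0" by auto
  also have "(\<lambda>j. \<alpha> j - ?e j) = \<alpha>(i := \<alpha> i - 1)" by auto
  finally show ?thesis .
qed

text \<open>Each nonconstant monomial is divided by the first variable occurring in it.\<close>

lemma max_ideal_decompose: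
  assumes f: "f \<in> max_ideal n"
  obtains h where "\<And>i. i < n \<Longrightarrow> h i \<in> PS n"
    "f = (\<lambda>\<alpha>. \<Sum>i<n. ps_mult (ps_var i) (h i) \<alpha>)"
    "\<And>i p. i < n \<Longrightarrow> agree n (Suc p) f (\<lambda>_. 0) \<Longrightarrow> agree n p (h i) (\<lambda>_. 0)"
proof
  define h where "h = (\<lambda>i \<alpha>. if \<forall>j<i. \<alpha> j = 0 then f (\<alpha>(i := Suc (\<alpha> i))) else 0)"
  have fPS: "f \<in> PS n" and f0: "f (\<lambda>_. 0) = 0" using f by (auto simp: max_ideal_def)
  show hPS: "h i \<in> PS n" if "i < n" for i
    unfolding PS_def
  proof safe
    fix \<alpha> assume "\<alpha> \<notin> mi n"
    then obtain j where "j \<ge> n" "\<alpha> j \<noteq> 0" by (auto simp: mi_def)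
    then have "\<alpha>(i := Suc (\<alpha> i)) \<notin> mi n" using that by (auto simp: mi_def)
    then show "h i \<alpha> = 0" using fPS by (auto simp: h_def PS_def)
  qed
  show "agree n p (h i) (\<lambda>_. 0)" if "i < n" "agree n (Suc p) f (\<lambda>_. 0)" for i p
    using that by (auto simp: agree_def h_def mdeg_Suc mi_def)
  show "f = (\<lambda>\<alpha>. \<Sum>i<n. ps_mult (ps_var i) (h i) \<alpha>)"
  proof
    fix \<alpha>
    show "f \<alpha> = (\<Sum>i<n. ps_mult (ps_var i) (h i) \<alpha>)"
    proof (cases "\<alpha> \<in> mi n")
      case False
      have "ps_mult (ps_var i) (h i) \<alpha> = 0" if "i < n" for i
        using PS_mult[OF PS_var[OF that] hPS[OF that]] False by (auto simp: PS_def)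
      then show ?thesis using fPS False by (auto simp: PS_def)
    next
      case mi: True
      show ?thesis
      proof (cases "\<alpha> = (\<lambda>_. 0)")
        case True
        then show ?thesis using ps_mult_var[OF mi] by (simp add: f0)
      next
        case False
        then have ex: "\<exists>i. \<alpha> i > 0" by auto
        define m where "m = (LEAST i. \<alpha> i > 0)"
        have m: "\<alpha> m > 0" unfolding m_def by (rule LeastI_ex[OF ex])
        have lt: "\<alpha> j = 0" if "j < m" for j
          using not_less_Least[of j "\<lambda>i. \<alpha> i > 0"] that by (auto simp: m_def)
        have "m < n" using m mi by (metis (mono_tags, lifting) mem_Collect_eq mi_def not_less less_irrefl)
        have "ps_mult (ps_var i) (h i) \<alpha> = (if i = m then f \<alpha> else 0)" for i
        proof (cases "i = m")
          case True
          then show ?thesis using m lt by (auto simp: ps_mult_var[OF mi] h_def)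
        next
          case ne: False
          show ?thesis
          proof (cases "i < m")
            case True then show ?thesis using lt ne by (auto simp: ps_mult_var[OF mi])
          next
            case False
            then have "m < i" using ne by auto
            then have "h i (\<alpha>(i := \<alpha> i - 1)) = 0" using m by (auto simp: h_def)
            then show ?thesis using ne by (auto simp: ps_mult_var[OF mi])
          qed
        qed
        then show ?thesis using \<open>m < n\<close> by simp
      qed
    qed
  qed
qed

text \<open>The splitting behind the inductions over the degree: an automorphism fixes the constant
  part, and the images of the quotients \<open>h i\<close> matter only to one order less, since the
  image of a variable has no constant term.\<close>

lemma PS_decompose:
  assumes f: "f \<in> PS n"
  obtains h where "\<And>i. i < n \<Longrightarrow> h i \<in> PS n"
    "f = ps_add (ps_scale (f (\<lambda>_. 0)) ps_one) (\<lambda>\<alpha>. \<Sum>i<n. ps_mult (ps_var i) (h i) \<alpha>)"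
proof -
  have "f((\<lambda>_. 0) := 0) \<in> max_ideal n" using f by (auto simp: max_ideal_def PS_def mi_def)
  then obtain h where h: "\<And>i. i < n \<Longrightarrow> h i \<in> PS n"
    "f((\<lambda>_. 0) := 0) = (\<lambda>\<alpha>. \<Sum>i<n. ps_mult (ps_var i) (h i) \<alpha>)"
    using max_ideal_decompose by metis
  have "f = ps_add (ps_scale (f (\<lambda>_. 0)) ps_one) (f((\<lambda>_. 0) := 0))"
    by (auto simp: ps_add_def ps_scale_def ps_one_def)
  then show thesis using that[of h] h by simp
qed

section \<open>Formal automorphisms and the filtration by order\<close>

locale autom =
  fixes n :: nat and \<Phi> :: "mser \<Rightarrow> mser"
  assumes Diff: "\<Phi> \<in> Diff n"
begin

lemma PS: "f \<in> PS n \<Longrightarrow> \<Phi> f \<in> PS n"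
  using Diff by (auto simp: Diff_def bij_betw_def)

lemma add: "f \<in> PS n \<Longrightarrow> g \<in> PS n \<Longrightarrow> \<Phi> (ps_add f g) = ps_add (\<Phi> f) (\<Phi> g)"
  and mult: "f \<in> PS n \<Longrightarrow> g \<in> PS n \<Longrightarrow> \<Phi> (ps_mult f g) = ps_mult (\<Phi> f) (\<Phi> g)"
  and scale: "f \<in> PS n \<Longrightarrow> \<Phi> (ps_scale c f) = ps_scale c (\<Phi> f)"
  and one: "\<Phi> ps_one = ps_one"
  using Diff by (auto simp: Diff_def)

lemma zero: "\<Phi> (\<lambda>_. 0) = (\<lambda>_. 0)"
  using scale[of "\<lambda>_. 0" 0] by (simp add: ps_scale_def)

lemma max_ideal: "f \<in> max_ideal n \<Longrightarrow> \<Phi> f \<in> max_ideal n"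
  using Diff by (auto simp: Diff_def)

lemma sum:
  assumes "finite I" "\<And>i. i \<in> I \<Longrightarrow> F i \<in> PS n"
  shows "\<Phi> (\<lambda>\<alpha>. \<Sum>i\<in>I. F i \<alpha>) = (\<lambda>\<alpha>. \<Sum>i\<in>I. \<Phi> (F i) \<alpha>)"
  using assms
proof (induction I rule: finite_induct)
  case empty then show ?case by (simp add: zero)
next
  case (insert x I)
  have "\<Phi> (ps_add (F x) (\<lambda>\<alpha>. \<Sum>i\<in>I. F i \<alpha>)) = ps_add (\<Phi> (F x)) (\<Phi> (\<lambda>\<alpha>. \<Sum>i\<in>I. F i \<alpha>))"
    using insert by (intro add PS_sum) auto
  then show ?case using insert by (simp add: ps_add_def)
qed

lemma decompose:
  assumes "\<And>i. i < n \<Longrightarrow> h i \<in> PS n"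
  shows "\<Phi> (\<lambda>\<alpha>. \<Sum>i<n. ps_mult (ps_var i) (h i) \<alpha>) =
     (\<lambda>\<alpha>. \<Sum>i<n. ps_mult (\<Phi> (ps_var i)) (\<Phi> (h i)) \<alpha>)"
proof -
  have "\<Phi> (\<lambda>\<alpha>. \<Sum>i<n. ps_mult (ps_var i) (h i) \<alpha>) =
     (\<lambda>\<alpha>. \<Sum>i<n. \<Phi> (ps_mult (ps_var i) (h i)) \<alpha>)"
    using assms by (intro sum) (auto intro: PS_mult PS_var)
  also have "\<dots> = (\<lambda>\<alpha>. \<Sum>i<n. ps_mult (\<Phi> (ps_var i)) (\<Phi> (h i)) \<alpha>)"
    using assms by (intro ext sum.cong) (auto simp: mult PS_var)
  finally show ?thesis .
qed

lemma PS_decompose_image: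
  assumes "\<And>i. i < n \<Longrightarrow> h i \<in> PS n"
    "f = ps_add (ps_scale c ps_one) (\<lambda>\<alpha>. \<Sum>i<n. ps_mult (ps_var i) (h i) \<alpha>)"
  shows "\<Phi> f = ps_add (ps_scale c ps_one) (\<lambda>\<alpha>. \<Sum>i<n. ps_mult (\<Phi> (ps_var i)) (\<Phi> (h i)) \<alpha>)"
proof -
  have "(\<lambda>\<alpha>. \<Sum>i<n. ps_mult (ps_var i) (h i) \<alpha>) \<in> PS n"
    using assms(1) by (auto intro!: PS_sum PS_mult PS_var)
  then show ?thesis
    unfolding assms(2) using decompose[OF assms(1)]
    by (simp add: add scale one PS_scale PS_one)
qed

lemma var_vanish: "i < n \<Longrightarrow> agree n 0 (\<Phi> (ps_var i)) (\<lambda>_. 0)"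
  using max_ideal[OF var_max_ideal] by (simp add: max_ideal_iff)

text \<open>Dividing by the variables loses one order of vanishing in the quotients
  \<open>h i\<close>; multiplying by the images of the variables, which have no constant term,
  regains it.\<close>

lemma vanish:
  "f \<in> PS n \<Longrightarrow> agree n p f (\<lambda>_. 0) \<Longrightarrow> agree n p (\<Phi> f) (\<lambda>_. 0)"
proof (induction p arbitrary: f)
  case 0 then show ?case using max_ideal[of f] by (simp add: max_ideal_iff)
next
  case (Suc p)
  then have "f \<in> max_ideal n" by (auto simp: max_ideal_iff intro: agree_mono)
  then obtain h where h: "\<And>i. i < n \<Longrightarrow> h i \<in> PS n"
    "f = (\<lambda>\<alpha>. \<Sum>i<n. ps_mult (ps_var i) (h i) \<alpha>)"
    "\<And>i p. i < n \<Longrightarrow> agree n (Suc p) f (\<lambda>_. 0) \<Longrightarrow> agree n p (h i) (\<lambda>_. 0)"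
    using max_ideal_decompose by blast
  have "agree n (Suc p) (\<lambda>\<alpha>. \<Sum>i<n. ps_mult (\<Phi> (ps_var i)) (\<Phi> (h i)) \<alpha>)
      (\<lambda>\<alpha>. \<Sum>i<n. ps_mult (\<Phi> (ps_var i)) (\<lambda>_. 0) \<alpha>)"
  proof (rule agree_sum)
    fix i assume "i \<in> {..<n}"
    then show "agree n (Suc p) (ps_mult (\<Phi> (ps_var i)) (\<Phi> (h i)))
        (ps_mult (\<Phi> (ps_var i)) (\<lambda>_. 0))"
      using agree_mult_right[OF var_vanish Suc.IH[OF h(1) h(3)[OF _ Suc.prems(2)]], of i] by simp
  qed
  then have "agree n (Suc p) (\<Phi> f) (\<lambda>\<alpha>. \<Sum>i<n. ps_mult (\<Phi> (ps_var i)) (\<lambda>_. 0) \<alpha>)"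
    using decompose[of h, OF h(1)] h(2) by simp
  then show ?case by simp
qed

lemma agree: 
  assumes "f \<in> PS n" "g \<in> PS n" "agree n p f g" shows "agree n p (\<Phi> f) (\<Phi> g)"
proof -
  have "agree n p (\<Phi> (ps_add f (ps_scale (-1) g))) (\<lambda>_. 0)"
    using assms by (intro vanish PS_add PS_scale) (auto simp: agree_def ps_add_def ps_scale_def)
  then show ?thesis
    using assms by (simp add: add scale PS_scale) (auto simp: agree_def ps_add_def ps_scale_def)
qed

text \<open>Replacing \<open>f\<close> by its finite truncation changes \<open>\<Phi> f\<close> only
  beyond degree \<open>p\<close>. So the action on \<open>p\<close>-jets is a finite matrix with
  entries \<open>\<Phi> (ps_mono \<beta>) \<alpha>\<close>, which makes translations act linearly on
  jet coordinates.\<close>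

lemma coeff_expansion:
  assumes f: "f \<in> PS n" and \<alpha>: "\<alpha> \<in> mi_le n p"
  shows "\<Phi> f \<alpha> = (\<Sum>\<beta>\<in>mi_le n p. f \<beta> * \<Phi> (ps_mono \<beta>) \<alpha>)"
proof -
  let ?t = "\<lambda>\<alpha>. \<Sum>\<beta>\<in>mi_le n p. ps_scale (f \<beta>) (ps_mono \<beta>) \<alpha>"
  have PSm: "ps_mono \<beta> \<in> PS n" if "\<beta> \<in> mi_le n p" for \<beta>
    using that by (simp add: PS_mono mi_le_def)
  have t: "?t \<in> PS n" using PSm by (auto intro!: PS_sum PS_scale)
  have "agree n p f ?t"
  proof -
    have "f \<beta> = ?t \<beta>" if "\<beta> \<in> mi_le n p" for \<beta>
    proof -
      have "?t \<beta> = (\<Sum>\<gamma>\<in>mi_le n p. if \<beta> = \<gamma> then f \<gamma> else 0)"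
        by (intro sum.cong) (auto simp: ps_scale_def ps_mono_def)
      then show ?thesis using that finite_mi_le[of n p] by simp
    qed
    then show ?thesis by (auto simp: agree_def mi_le_def)
  qed
  then have "agree n p (\<Phi> f) (\<Phi> ?t)" using f t agree by blast
  then have "\<Phi> f \<alpha> = \<Phi> ?t \<alpha>" using \<alpha> by (auto simp: agree_def mi_le_def)
  also have "\<Phi> ?t = (\<lambda>\<alpha>. \<Sum>\<beta>\<in>mi_le n p. \<Phi> (ps_scale (f \<beta>) (ps_mono \<beta>)) \<alpha>)"
    using PSm by (intro sum finite_mi_le PS_scale) auto
  also have "\<dots> \<alpha> = (\<Sum>\<beta>\<in>mi_le n p. f \<beta> * \<Phi> (ps_mono \<beta>) \<alpha>)"
    using PSm by (intro sum.cong) (auto simp: scale, simp add: ps_scale_def)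
  finally show ?thesis .
qed

text \<open>The action on leading terms is determined by the linear part, which is trivial here. In
  each product of a variable and a quotient the two factors are replaced by their images one at a
  time, and either replacement costs only terms of degree above \<open>q + 1\<close>.\<close>

lemma tangent_identity_on_order:
  assumes t: "\<And>f. f \<in> PS n \<Longrightarrow> agree n 1 (\<Phi> f) f"
  shows "w \<in> PS n \<Longrightarrow> agree n q w (\<lambda>_. 0) \<Longrightarrow> agree n (Suc q) (\<Phi> w) w"
proof (induction q arbitrary: w)
  case 0 then show ?case using t by simp
next
  case (Suc q)
  then have "w \<in> max_ideal n" by (auto simp: max_ideal_iff intro: agree_mono)
  then obtain h where h: "\<And>i. i < n \<Longrightarrow> h i \<in> PS n"
    "w = (\<lambda>\<alpha>. \<Sum>i<n. ps_mult (ps_var i) (h i) \<alpha>)"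
    "\<And>i p. i < n \<Longrightarrow> agree n (Suc p) w (\<lambda>_. 0) \<Longrightarrow> agree n p (h i) (\<lambda>_. 0)"
    using max_ideal_decompose by blast
  have "agree n (Suc (Suc q)) (\<lambda>\<alpha>. \<Sum>i<n. ps_mult (\<Phi> (ps_var i)) (\<Phi> (h i)) \<alpha>)
     (\<lambda>\<alpha>. \<Sum>i<n. ps_mult (ps_var i) (h i) \<alpha>)"
  proof (rule agree_sum)
    fix i assume "i \<in> {..<n}" then have i: "i < n" by simp
    have h0: "agree n q (h i) (\<lambda>_. 0)" using h(3)[OF i Suc.prems(2)] .
    have "agree n (Suc (Suc q)) (ps_mult (\<Phi> (ps_var i)) (\<Phi> (h i))) (ps_mult (\<Phi> (ps_var i)) (h i))"
      using agree_mult_right[OF var_vanish[OF i] Suc.IH[OF h(1)[OF i] h0]] by simp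
    moreover have "agree n (Suc (Suc q)) (ps_mult (\<Phi> (ps_var i)) (h i)) (ps_mult (ps_var i) (h i))"
      using agree_mult_left[OF t[OF PS_var[OF i]] h0] by simp
    ultimately show "agree n (Suc (Suc q)) (ps_mult (\<Phi> (ps_var i)) (\<Phi> (h i))) (ps_mult (ps_var i) (h i))"
      by (rule agree_trans)
  qed
  then show ?case using decompose[of h, OF h(1)] h(2) by simp
qed

end

text \<open>An automorphism is determined on \<open>p\<close>-jets by the images of the variables,
  with no appeal to continuity: in degree at most \<open>j + 1\<close> the quotients are needed only
  up to degree \<open>j\<close>, because the images of the variables start in degree one.\<close>

lemma Diff_agree_from_vars:
  assumes "\<Phi> \<in> Diff n" "\<Psi> \<in> Diff n"
    and vars: "\<And>i. i < n \<Longrightarrow> agree n p (\<Phi> (ps_var i)) (\<Psi> (ps_var i))"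
    and "f \<in> PS n"
  shows "agree n p (\<Phi> f) (\<Psi> f)"
proof -
  interpret \<Phi>: autom n \<Phi> by standard fact
  interpret \<Psi>: autom n \<Psi> by standard fact
  have "j \<le> p \<Longrightarrow> agree n j (\<Phi> f) (\<Psi> f)" if "f \<in> PS n" for f j
    using that
  proof (induction j arbitrary: f)
    case 0
    obtain h where h: "\<And>i. i < n \<Longrightarrow> h i \<in> PS n"
      "f = ps_add (ps_scale (f (\<lambda>_. 0)) ps_one) (\<lambda>\<alpha>. \<Sum>i<n. ps_mult (ps_var i) (h i) \<alpha>)"
      using PS_decompose[OF 0(2)] by metis
    have "agree n 0 (ps_mult (\<Phi> (ps_var i)) (\<Phi> (h i))) (ps_mult (\<Psi> (ps_var i)) (\<Psi> (h i)))"
      if "i < n" for i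
    proof -
      have "agree n 0 (ps_mult u v) (\<lambda>_. 0)" if "agree n 0 u (\<lambda>_. 0)" for u v
        using agree_mult[OF that, of v] by (simp add: ps_mult_def)
      then show ?thesis
        using \<Phi>.var_vanish[OF that] \<Psi>.var_vanish[OF that] by (meson agree_sym agree_trans)
    qed
    moreover note \<Phi>.PS_decompose_image[OF _ h(2), simplified h(1)] \<Psi>.PS_decompose_image[OF _ h(2), simplified h(1)]
    ultimately show ?case by (auto intro!: agree_add agree_sum)
  next
    case (Suc j)
    obtain h where h: "\<And>i. i < n \<Longrightarrow> h i \<in> PS n"
      "f = ps_add (ps_scale (f (\<lambda>_. 0)) ps_one) (\<lambda>\<alpha>. \<Sum>i<n. ps_mult (ps_var i) (h i) \<alpha>)"
      using PS_decompose[OF Suc.prems(2)] by metis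
    have "agree n (Suc j) (ps_mult (\<Phi> (ps_var i)) (\<Phi> (h i))) (ps_mult (\<Psi> (ps_var i)) (\<Psi> (h i)))"
      if i: "i < n" for i
    proof -
      have "agree n j (\<Phi> (h i)) (\<Psi> (h i))" using Suc.IH h(1)[OF i] Suc.prems by simp
      from agree_mult_right[OF \<Phi>.var_vanish[OF i] this]
      have "agree n (Suc j) (ps_mult (\<Phi> (ps_var i)) (\<Phi> (h i))) (ps_mult (\<Phi> (ps_var i)) (\<Psi> (h i)))"
        by simp
      moreover have "agree n (Suc j) (ps_mult (\<Phi> (ps_var i)) (\<Psi> (h i))) (ps_mult (\<Psi> (ps_var i)) (\<Psi> (h i)))"
        using agree_mult agree_mono[OF vars[OF i] Suc.prems(1)] by blast
      ultimately show ?thesis by (rule agree_trans)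
    qed
    moreover note \<Phi>.PS_decompose_image[OF _ h(2), simplified h(1)] \<Psi>.PS_decompose_image[OF _ h(2), simplified h(1)]
    ultimately show ?case by (auto intro!: agree_add agree_sum)
  qed
  then show ?thesis using assms(4) by blast
qed

text \<open>On the graded piece of degree \<open>q + 1\<close> the factor \<open>\<Phi>' = \<Phi>\<^sup>-\<^sup>1\<close> cancels the linear action of
  \<open>\<Phi>\<close>, so right translation by \<open>\<Delta>\<close> becomes an honest translation.\<close>

lemma layer_translation:
  assumes Diffs: "\<Phi> \<in> Diff n" "\<Phi>' \<in> Diff n" "\<Delta> \<in> Diff n" "\<Delta>' \<in> Diff n"
    and inv: "\<And>f. f \<in> PS n \<Longrightarrow> \<Phi>' (\<Phi> f) = f"
    and t: "\<And>f. f \<in> PS n \<Longrightarrow> agree n 1 (\<Delta>' f) f"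
    and y: "y \<in> PS n" "agree n q (\<Delta> y) y"
    and \<alpha>: "\<alpha> \<in> mi n" "mdeg n \<alpha> = Suc q"
  shows "\<Delta>' (\<Phi>' (ps_hom n (Suc q) (\<Phi> (\<Delta> y)))) \<alpha> =
     \<Phi>' (ps_hom n (Suc q) (\<Phi> y)) \<alpha> + (\<Delta> y \<alpha> - y \<alpha>)"
proof -
  interpret \<Phi>: autom n \<Phi> by standard fact
  interpret \<Phi>': autom n \<Phi>' by standard fact
  interpret \<Delta>: autom n \<Delta> by standard fact
  interpret \<Delta>': autom n \<Delta>' by standard fact
  define r where "r = ps_add (\<Delta> y) (ps_scale (-1) y)"
  have r: "r \<in> PS n" unfolding r_def using y \<Delta>.PS by (auto intro: PS_add PS_scale)
  have r0: "agree n q r (\<lambda>_. 0)"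
    using y(2) by (auto simp: r_def agree_def ps_add_def ps_scale_def)
  have \<Delta>y: "\<Delta> y = ps_add y r" by (auto simp: r_def ps_add_def ps_scale_def)
  have homz: "agree n q (ps_hom n (Suc q) u) (\<lambda>_. 0)" for u by (auto simp: agree_def ps_hom_def)
  let ?w = "\<Phi>' (ps_hom n (Suc q) (\<Phi> (\<Delta> y)))"
  have hPS: "ps_hom n (Suc q) (\<Phi> u) \<in> PS n" if "u \<in> PS n" for u using that \<Phi>.PS PS_hom by blast
  have w: "?w \<in> PS n" using \<Phi>'.PS hPS \<Delta>.PS y(1) by blast
  have "agree n q ?w (\<lambda>_. 0)" using \<Phi>'.vanish hPS \<Delta>.PS y(1) homz by blast
  \<comment> \<open>\<open>?w\<close> starts in degree \<open>q + 1\<close>, where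
    \<open>\<Delta>'\<close> acts trivially, so the outer factor disappears.\<close>
  then have 1: "\<Delta>' ?w \<alpha> = ?w \<alpha>"
    using \<Delta>'.tangent_identity_on_order[OF t w] \<alpha> by (auto simp: agree_def)
  have 2: "ps_hom n (Suc q) (\<Phi> (\<Delta> y)) = ps_add (ps_hom n (Suc q) (\<Phi> y)) (ps_hom n (Suc q) (\<Phi> r))"
    unfolding \<Delta>y \<Phi>.add[OF y(1) r] by (auto simp: ps_hom_def ps_add_def)
  have "?w \<alpha> = \<Phi>' (ps_hom n (Suc q) (\<Phi> y)) \<alpha> + \<Phi>' (ps_hom n (Suc q) (\<Phi> r)) \<alpha>"
    unfolding 2 \<Phi>'.add[OF hPS[OF y(1)] hPS[OF r]] by (simp add: ps_add_def)
  \<comment> \<open>As \<open>\<Phi> r\<close> has no terms below degree \<open>q + 1\<close>, its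
    homogeneous part of that degree is its whole jet there, and \<open>\<Phi>'\<close> undoes
    \<open>\<Phi>\<close> up to that order.\<close>
  also have "\<Phi>' (ps_hom n (Suc q) (\<Phi> r)) \<alpha> = r \<alpha>"
  proof -
    have "agree n (Suc q) (ps_hom n (Suc q) (\<Phi> r)) (\<Phi> r)"
      using \<Phi>.vanish[OF r r0] by (auto simp: agree_def ps_hom_def le_Suc_eq)
    then have "agree n (Suc q) (\<Phi>' (ps_hom n (Suc q) (\<Phi> r))) (\<Phi>' (\<Phi> r))"
      using \<Phi>'.agree hPS r \<Phi>.PS by blast
    then show ?thesis using \<alpha> inv[OF r] by (auto simp: agree_def)
  qed
  also have "r \<alpha> = \<Delta> y \<alpha> - y \<alpha>" by (simp add: r_def ps_add_def ps_scale_def)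
  finally show ?thesis using 1 by simp
qed

subsection \<open>Maps whose derivative has a kernel of constant dimension\<close>

text \<open>The kernel at \<open>x\<close> of the derivative of the map with components
  \<open>u c\<close>, provided that these are differentiable at \<open>x\<close>.\<close>

definition joint_kernel :: "('c \<Rightarrow> 'e::euclidean_space \<Rightarrow> 'd::euclidean_space) \<Rightarrow> 'c set \<Rightarrow> 'e \<Rightarrow> 'e set" where
  "joint_kernel u C x = {v. \<forall>c\<in>C. frechet_derivative (u c) (at x) v = 0}"

lemma subspace_joint_kernel:
  assumes "\<And>c. c \<in> C \<Longrightarrow> u c differentiable (at x)"
  shows "subspace (joint_kernel u C x)"
proof -
  have "linear (frechet_derivative (u c) (at x))" if "c \<in> C" for c
    using assms[OF that] by (rule linear_frechet_derivative)
  then show ?thesis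
    unfolding joint_kernel_def by (intro subspaceI) (auto simp: linear_0 linear_add linear_scale)
qed

text \<open>With \<open>Q\<close> the orthogonal projection onto the joint kernel \<open>E\<close> at \<open>a\<close> and \<open>D\<close> the derivatives at \<open>a\<close>,
  the map \<open>H x = Q x + (\<Sum>c\<in>C. (D c)\<^sup>* (u c x))\<close> is a local diffeomorphism at \<open>a\<close>: its derivative
  is positive definite there. Either \<open>E\<close> vanishes and \<open>H\<close> only depends on \<open>u\<close>, or lines in direction \<open>E\<close>
  pull back to curves tangent to the joint kernels.\<close>

lemma constant_kernel_curve_or_injective:
  fixes u :: "'c \<Rightarrow> 'e::euclidean_space \<Rightarrow> 'd::euclidean_space"
  assumes C: "finite C" and X: "open X" "a \<in> X"
    and C1: "\<And>c. c \<in> C \<Longrightarrow> Ck_on 1 X (u c)"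
    and dim: "\<And>x. x \<in> X \<Longrightarrow> dim (joint_kernel u C x) = dim (joint_kernel u C a)"
  obtains (injective) S where "open S" "a \<in> S" "S \<subseteq> X"
      "\<And>x. x \<in> S \<Longrightarrow> (\<And>c. c \<in> C \<Longrightarrow> u c x = u c a) \<Longrightarrow> x = a"
  | (curve) \<gamma> \<gamma>' \<epsilon> where "\<epsilon> > 0" "\<gamma> 0 = a" "\<And>t. \<bar>t\<bar> < \<epsilon> \<Longrightarrow> \<gamma> t \<in> X"
      "\<And>t. \<bar>t\<bar> < \<epsilon> \<Longrightarrow> (\<gamma> has_vector_derivative \<gamma>' t) (at t)"
      "\<And>t. \<bar>t\<bar> < \<epsilon> \<Longrightarrow> \<gamma>' t \<in> joint_kernel u C (\<gamma> t)"
      "\<And>t. \<bar>t\<bar> < \<epsilon> \<Longrightarrow> t \<noteq> 0 \<Longrightarrow> \<gamma> t \<noteq> a"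
proof -
  define D where "D = (\<lambda>c x. frechet_derivative (u c) (at x))"
  define E where "E = joint_kernel u C a"
  define A where "A = (\<lambda>c. adjoint (D c a))"
  have diff: "u c differentiable (at x)" if "c \<in> C" "x \<in> X" for c x
    using C1[OF that(1)] X that(2) by (auto simp: differentiable_on_eq_differentiable_at)
  have D: "(u c has_derivative D c x) (at x)" if "c \<in> C" "x \<in> X" for c x
    using diff[OF that] by (simp add: D_def frechet_derivative_works)
  have linD: "linear (D c x)" if "c \<in> C" "x \<in> X" for c x
    using D[OF that] by (rule has_derivative_linear)
  have contD: "continuous_on X (\<lambda>x. D c x b)" if "c \<in> C" "b \<in> Basis" for c b
    using C1[OF that(1)] that(2) by (auto simp: D_def)
  have linA: "linear (A c)" if "c \<in> C" for c
    using linD[OF that X(2)] by (simp add: A_def adjoint_linear)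
  have A: "v \<bullet> A c y = D c a v \<bullet> y" if "c \<in> C" for c v y
    unfolding A_def using linD[OF that X(2)] by (rule adjoint_works)
  have subE: "subspace (joint_kernel u C x)" if "x \<in> X" for x
    using diff that by (intro subspace_joint_kernel) auto
  obtain B where B: "B \<subseteq> E" "pairwise orthogonal B" "\<And>x. x \<in> B \<Longrightarrow> norm x = 1" "independent B"
    "span B = E"
    using orthonormal_basis_subspace[OF subE[OF X(2)]] unfolding E_def by metis
  have finB: "finite B" using B(4) by (rule independent_imp_finite)
  define Q where "Q = (\<lambda>v. \<Sum>b\<in>B. (b \<bullet> v) *\<^sub>R b)"
  have linQ: "linear Q" unfolding Q_def
    by (intro linearI) (auto simp: inner_add_right scaleR_left_distrib sum.distrib scaleR_sum_right)
  have QE: "Q v \<in> E" for v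
    unfolding Q_def B(5)[symmetric] by (intro span_sum span_scale span_base)
  have E0: "v = 0" if "v \<in> E" "\<And>b. b \<in> B \<Longrightarrow> b \<bullet> v = 0" for v
  proof -
    have "orthogonal v x" if "x \<in> span B" for x
      using that \<open>\<And>b. b \<in> B \<Longrightarrow> b \<bullet> v = 0\<close> orthogonal_to_span[of x B v]
      by (auto simp: orthogonal_def inner_commute)
    then show ?thesis using that(1) B(5) inner_eq_zero_iff[of v] by (simp add: orthogonal_def)
  qed
  define S where "S = (\<lambda>x v. \<Sum>c\<in>C. A c (D c x v))"
  define H where "H = (\<lambda>x. Q x + (\<Sum>c\<in>C. A c (u c x)))"
  define H' where "H' = (\<lambda>x. Blinfun (\<lambda>v. Q v + S x v))"
  have derA: "((\<lambda>x. A c (u c x)) has_derivative (\<lambda>v. A c (D c x v))) (at x)" if "c \<in> C" "x \<in> X" for c x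
    using bounded_linear.has_derivative[OF linear_linear[THEN iffD2, OF linA[OF that(1)]] D[OF that]]
    by (simp add: linear_conv_bounded_linear)
  have derH: "(H has_derivative (\<lambda>v. Q v + S x v)) (at x)" if "x \<in> X" for x
    unfolding H_def S_def
    using that derA linear_imp_has_derivative[OF linQ]
    by (intro has_derivative_add has_derivative_sum) blast+
  have H': "blinfun_apply (H' x) = (\<lambda>v. Q v + S x v)" if "x \<in> X" for x
    unfolding H'_def using has_derivative_bounded_linear[OF derH[OF that]]
    by (rule bounded_linear_Blinfun_apply)
  have contH': "continuous_on X H'"
  proof (rule continuous_on_blinfun_componentwise)
    fix b :: 'e assume b: "b \<in> Basis"
    have "continuous_on X (\<lambda>x. A c (D c x b))" if "c \<in> C" for c
      using linear_continuous_on_compose[OF contD[OF that b]] linA[OF that] by blast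
    then have "continuous_on X (\<lambda>x. Q b + S x b)"
      unfolding S_def by (intro continuous_intros) auto
    then show "continuous_on X (\<lambda>x. blinfun_apply (H' x) b)"
      by (rule continuous_on_eq) (simp add: H')
  qed
  have linS: "linear (S x)" if "x \<in> X" for x
    unfolding S_def
    using linear_compose[OF linD[OF _ that] linA] by (intro linear_compose_sum) (simp add: o_def)
  have inj: "v = 0" if "Q v + S a v = 0" for v
  proof -
    have "v \<bullet> (Q v + S a v) = (\<Sum>b\<in>B. (b \<bullet> v)\<^sup>2) + (\<Sum>c\<in>C. (norm (D c a v))\<^sup>2)"
      by (simp add: Q_def S_def inner_add_right inner_sum_right A power2_norm_eq_inner)
         (simp add: power2_eq_square inner_commute)
    then have z: "(\<Sum>b\<in>B. (b \<bullet> v)\<^sup>2) + (\<Sum>c\<in>C. (norm (D c a v))\<^sup>2) = 0"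
      using that by simp
    have "(\<Sum>b\<in>B. (b \<bullet> v)\<^sup>2) \<ge> 0" "(\<Sum>c\<in>C. (norm (D c a v))\<^sup>2) \<ge> 0"
      by (auto intro: sum_nonneg)
    then have z1: "(\<Sum>b\<in>B. (b \<bullet> v)\<^sup>2) = 0" and z2: "(\<Sum>c\<in>C. (norm (D c a v))\<^sup>2) = 0"
      using z by linarith+
    have "v \<in> E" using z2 C by (simp add: E_def joint_kernel_def sum_nonneg_eq_0_iff D_def)
    moreover have "b \<bullet> v = 0" if "b \<in> B" for b using z1 finB that by (simp add: sum_nonneg_eq_0_iff)
    ultimately show "v = 0" by (rule E0)
  qed
  have "linear (\<lambda>v. Q v + S a v)" using linQ linS[OF X(2)] by (rule linear_compose_add)
  moreover have "inj (\<lambda>v. Q v + S a v)"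
    unfolding linear_injective_0[OF calculation] using inj by blast
  ultimately obtain I where I: "linear I" "I \<circ> (\<lambda>v. Q v + S a v) = id"
    using linear_injective_left_inverse by blast
  have derH': "(H has_derivative blinfun_apply (H' x)) (at x)" if "x \<in> X" for x
    using derH[OF that] H'[OF that] by simp
  have inv: "Blinfun I o\<^sub>L H' a = id_blinfun"
    using I by (intro blinfun_eqI)
      (simp add: H'[OF X(2)] bounded_linear_Blinfun_apply linear_conv_bounded_linear fun_eq_iff)
  obtain U' V g g' where U': "open U'" "U' \<subseteq> X" "a \<in> U'" and V: "open V" "H a \<in> V"
    and hom: "homeomorphism U' V H g"
    and g: "\<And>y. y \<in> V \<Longrightarrow> (g has_derivative (g' y)) (at y)"
      "\<And>y. y \<in> V \<Longrightarrow> g' y = inv_into UNIV (blinfun_apply (H'(g y)))"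
      "\<And>y. y \<in> V \<Longrightarrow> bij (blinfun_apply (H'(g y)))"
    by (rule inverse_function_theorem[OF X(1) derH' contH' X(2) inv]) (assumption | rule that)+
  show thesis
  proof (cases "E = {0}")
    case True
    show thesis
    proof (rule injective[OF U'(1,3,2)])
      fix x assume x: "x \<in> U'" "\<And>c. c \<in> C \<Longrightarrow> u c x = u c a"
      have "Q y = 0" for y using QE[of y] True by simp
      then have "H x = H a" using x by (simp add: H_def)
      then show "x = a" using hom x(1) U'(3) unfolding homeomorphism_def by metis
    qed
  next
    case False
    then obtain v where v: "v \<in> E" "v \<noteq> 0"
      using subspace_0[OF subE[OF X(2)]] by (auto simp: E_def)
    obtain r where r: "r > 0" "ball (H a) r \<subseteq> V" using V by (meson open_contains_ball)
    define \<gamma> where "\<gamma> = (\<lambda>t::real. g (H a + t *\<^sub>R v))"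
    define \<gamma>' where "\<gamma>' = (\<lambda>t::real. g' (H a + t *\<^sub>R v) v)"
    \<comment> \<open>For parameters below this bound the segment in direction \<open>v\<close>
      stays in the ball of radius \<open>r\<close> around \<open>H a\<close>, where the inverse
      \<open>g\<close> is available.\<close>
    define \<epsilon> where "\<epsilon> = r / norm v"
    have inV: "H a + t *\<^sub>R v \<in> V" if "\<bar>t\<bar> < \<epsilon>" for t
    proof -
      have "norm (t *\<^sub>R v) < r" using that v(2) by (simp add: \<epsilon>_def field_simps)
      then have "H a + t *\<^sub>R v \<in> ball (H a) r" by (simp add: dist_norm)
      then show ?thesis using r by blast
    qed
    have gV: "g y \<in> U'" "H (g y) = y" if "y \<in> V" for y
      using hom that by (auto simp: homeomorphism_def)
    have ker: "\<gamma>' t \<in> joint_kernel u C (\<gamma> t)" if t: "\<bar>t\<bar> < \<epsilon>" for t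
    proof -
      let ?x = "\<gamma> t"
      have x: "?x \<in> X" unfolding \<gamma>_def using gV(1)[OF inV[OF t]] U'(2) by blast
      have Hx: "bij (\<lambda>w. Q w + S ?x w)" using g(3)[OF inV[OF t]] H'[OF x] by (simp add: \<gamma>_def)
      have "\<gamma>' t = inv_into UNIV (\<lambda>w. Q w + S ?x w) v"
        unfolding \<gamma>'_def g(2)[OF inV[OF t]] using H'[OF x] by (simp add: \<gamma>_def)
      then have eq: "Q (\<gamma>' t) + S ?x (\<gamma>' t) = v"
        using Hx by (metis (mono_tags, lifting) bij_inv_eq_iff)
      \<comment> \<open>All values of \<open>A c\<close> are orthogonal to \<open>E\<close>, hence
        so are those of \<open>S ?x\<close>. The value at \<open>\<gamma>' t\<close> also equals
        \<open>v - Q (\<gamma>' t)\<close>, an element of \<open>E\<close>, so it must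
        vanish.\<close>
      have "b \<bullet> S ?x w = 0" if "b \<in> E" for b w
        using that by (simp add: S_def inner_sum_right A E_def joint_kernel_def D_def)
      moreover have "S ?x (\<gamma>' t) = v - Q (\<gamma>' t)" using eq by (simp add: algebra_simps)
      moreover have "v - Q (\<gamma>' t) \<in> E"
        using subspace_diff[OF subE[OF X(2)]] v(1) QE by (simp add: E_def)
      ultimately have S0: "S ?x (\<gamma>' t) = 0" by (metis inner_eq_zero_iff)
      \<comment> \<open>The constant dimension enters here: \<open>K\<close> contains the joint
        kernel at \<open>?x\<close>, and \<open>Q\<close> maps \<open>K\<close> injectively into
        \<open>E\<close>, whose dimension is that of the joint kernel. So the two spaces
        coincide.\<close>
      define K where "K = {w. S ?x w = 0}"
      have subK: "subspace K" unfolding K_def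
        using linS[OF x] by (intro subspaceI) (auto simp: linear_0 linear_add linear_scale)
      have sub: "joint_kernel u C ?x \<subseteq> K"
        using linA by (auto simp: joint_kernel_def K_def S_def D_def linear_0 intro!: sum.neutral)
      have "inj_on Q K"
      proof (rule inj_onI)
        fix w w' assume w: "w \<in> K" "w' \<in> K" "Q w = Q w'"
        then have "(\<lambda>w. Q w + S ?x w) w = (\<lambda>w. Q w + S ?x w) w'" by (simp add: K_def)
        then show "w = w'" using Hx by (meson bij_def injD)
      qed
      then have "dim K = dim (Q ` K)"
        using dim_image_eq[OF linQ, of K] subK by (simp add: span_eq_iff[THEN iffD2])
      also have "\<dots> \<le> dim E" using QE by (intro dim_subset) auto
      also have "\<dots> = dim (joint_kernel u C ?x)" using dim[OF x] by (simp add: E_def)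
      finally have "joint_kernel u C ?x = K"
        using subspace_dim_equal[OF subE[OF x] subK sub] by simp
      then show ?thesis using S0 by (simp add: K_def)
    qed
    show thesis
    proof (rule curve[of \<epsilon> \<gamma> \<gamma>'])
      show "\<epsilon> > 0" using r v by (simp add: \<epsilon>_def)
      show \<gamma>0: "\<gamma> 0 = a" using hom U'(3) by (simp add: \<gamma>_def homeomorphism_def)
      fix t :: real assume t: "\<bar>t\<bar> < \<epsilon>"
      show "\<gamma> t \<in> X" unfolding \<gamma>_def using gV(1)[OF inV[OF t]] U'(2) by blast
      have lin: "linear (g' (H a + t *\<^sub>R v))" using g(1)[OF inV[OF t]] by (rule has_derivative_linear)
      have "((\<lambda>t. H a + t *\<^sub>R v) has_derivative (\<lambda>h. h *\<^sub>R v)) (at t)"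
        by (auto intro!: derivative_eq_intros)
      from has_derivative_compose[OF this g(1)[OF inV[OF t]]]
      show "(\<gamma> has_vector_derivative \<gamma>' t) (at t)"
        by (simp add: has_vector_derivative_def \<gamma>_def \<gamma>'_def linear_scale[OF lin])
      show "\<gamma>' t \<in> joint_kernel u C (\<gamma> t)" using ker[OF t] .
      show "\<gamma> t \<noteq> a" if "t \<noteq> 0"
      proof
        assume "\<gamma> t = a"
        then have "H a + t *\<^sub>R v = H a" using gV(2)[OF inV[OF t]] by (simp add: \<gamma>_def)
        then show False using that v(2) by simp
      qed
    qed
  qed
qed

subsection \<open>Quasi-periodic maps of triangular type\<close>

text \<open>Modulo the shifts by \<open>b j, b (j+1), \<dots>\<close> the displacement of the \<open>j\<close>-th coordinate is a function on a compact
  set as soon as the coordinates before it are bounded. Hence a large enough box is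
  displaced by less than its size and Brouwer's theorem applies.\<close>

lemma triangular_quasiperiodic_image_not_negligible:
  fixes \<Phi> :: "'v::euclidean_space \<Rightarrow> 'v" and b :: "nat \<Rightarrow> 'v"
  assumes b: "bij_betw b {..<k} Basis" and cont: "continuous_on UNIV \<Phi>"
    and shift: "\<And>i j v m. j \<le> i \<Longrightarrow> i < k \<Longrightarrow>
      \<Phi> (v + of_int m *\<^sub>R b i) \<bullet> b j = \<Phi> v \<bullet> b j + (if i = j then of_int m else 0)"
  obtains S where "compact S" "\<not> negligible (\<Phi> ` S)"
proof -
  have bB: "b i \<in> Basis" if "i < k" for i using b that by (auto simp: bij_betw_def)
  have inn: "b i \<bullet> b j = (if i = j then 1 else 0)" if "i < k" "j < k" for i j
    using b that bB by (auto simp: inner_Basis bij_betw_def inj_on_def)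
  have coord: "(\<Sum>i\<in>I. c i *\<^sub>R b i) \<bullet> b j = (if j \<in> I then c j else 0)"
    if "I \<subseteq> {..<k}" "j < k" for c :: "nat \<Rightarrow> real" and I j
  proof -
    have "(\<Sum>i\<in>I. c i *\<^sub>R b i) \<bullet> b j = (\<Sum>i\<in>I. if i = j then c i else 0)"
      unfolding inner_sum_left using that by (intro sum.cong) (auto simp: inn subset_iff)
    then show ?thesis using finite_subset[OF that(1)] by (simp add: sum.delta)
  qed
  have box: "v \<in> cbox (-h) h \<longleftrightarrow> (\<forall>j<k. \<bar>v \<bullet> b j\<bar> \<le> h \<bullet> b j)" for v h :: 'v
  proof -
    have "v \<in> cbox (-h) h \<longleftrightarrow> (\<forall>i\<in>b ` {..<k}. \<bar>v \<bullet> i\<bar> \<le> h \<bullet> i)"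
      using b by (auto simp: mem_box bij_betw_def abs_le_iff)
    then show ?thesis by auto
  qed
  define \<delta> where "\<delta> = (\<lambda>j v. \<Phi> v \<bullet> b j - v \<bullet> b j)"
  have per: "\<delta> j (v + (\<Sum>i\<in>I. of_int (m i) *\<^sub>R b i)) = \<delta> j v"
    if "finite I" "I \<subseteq> {j..<k}" "j < k" for I j v and m :: "nat \<Rightarrow> int"
    using that
  proof (induction I arbitrary: v rule: finite_induct)
    case (insert x I)
    have "\<delta> j (v + (\<Sum>i\<in>insert x I. of_int (m i) *\<^sub>R b i)) =
        \<delta> j ((v + of_int (m x) *\<^sub>R b x) + (\<Sum>i\<in>I. of_int (m i) *\<^sub>R b i))"
      using insert by (simp add: add.assoc)
    also have "\<dots> = \<delta> j (v + of_int (m x) *\<^sub>R b x)" using insert by auto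
    also have "\<dots> = \<delta> j v"
      using insert.prems by (auto simp: \<delta>_def shift inner_add_left inn)
    finally show ?case .
  qed simp
  have cont\<delta>: "continuous_on UNIV (\<delta> j)" for j
    unfolding \<delta>_def by (intro continuous_intros cont)
  \<comment> \<open>The constants are found one coordinate at a time, each depending on those before
    it. The margin in \<open>C l + 1\<close> leaves room for a target point with coordinates of
    absolute value at most one.\<close>
  have "\<exists>C. \<forall>j<m. C j \<ge> 0 \<and> (\<forall>v. (\<forall>l<j. \<bar>v \<bullet> b l\<bar> \<le> C l + 1) \<longrightarrow> \<bar>\<delta> j v\<bar> \<le> C j)" if "m \<le> k" for m
    using that
  proof (induction m)
    case (Suc m)
    then obtain C where C: "\<And>j. j < m \<Longrightarrow> C j \<ge> 0"
      "\<And>j v. j < m \<Longrightarrow> (\<And>l. l < j \<Longrightarrow> \<bar>v \<bullet> b l\<bar> \<le> C l + 1) \<Longrightarrow> \<bar>\<delta> j v\<bar> \<le> C j"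
      by auto
    define h where "h = (\<Sum>i<k. (if i < m then C i + 1 else 1) *\<^sub>R b i)"
    have "bounded (\<delta> m ` cbox (-h) h)"
      using continuous_on_subset[OF cont\<delta>] by (intro compact_imp_bounded compact_continuous_image) auto
    then obtain D where D: "D > 0" "\<And>v. v \<in> cbox (-h) h \<Longrightarrow> \<bar>\<delta> m v\<bar> \<le> D"
      by (auto simp: bounded_pos)
    have bound: "\<bar>\<delta> m v\<bar> \<le> D" if v: "\<And>l. l < m \<Longrightarrow> \<bar>v \<bullet> b l\<bar> \<le> C l + 1" for v
    proof -
      \<comment> \<open>Subtracting integer parts brings the coordinates from \<open>m\<close> on
        into the unit interval without changing \<open>\<delta> m\<close>; the earlier ones are
        bounded by assumption, so the point lands in a fixed compact box.\<close>
      let ?s = "\<Sum>i\<in>{m..<k}. of_int (- \<lfloor>v \<bullet> b i\<rfloor>) *\<^sub>R b i"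
      have "\<bar>(v + ?s) \<bullet> b l\<bar> \<le> h \<bullet> b l" if "l < k" for l
      proof -
        have hl: "h \<bullet> b l = (if l < m then C l + 1 else 1)"
          unfolding h_def using coord[of "{..<k}" l] that by simp
        have "(v + ?s) \<bullet> b l = (if l < m then v \<bullet> b l else v \<bullet> b l - of_int \<lfloor>v \<bullet> b l\<rfloor>)"
          unfolding inner_add_left using that by (subst coord) auto
        moreover have "\<bar>v \<bullet> b l - of_int \<lfloor>v \<bullet> b l\<rfloor>\<bar> \<le> 1" by linarith
        ultimately show ?thesis using v[of l] hl by presburger
      qed
      then have "v + ?s \<in> cbox (-h) h" unfolding box by blast
      then have "\<bar>\<delta> m (v + ?s)\<bar> \<le> D" by (rule D(2))
      then show ?thesis using per[of "{m..<k}" m v "\<lambda>i. - \<lfloor>v \<bullet> b i\<rfloor>"] Suc.prems by simp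
    qed
    have "(C(m := D)) j \<ge> 0 \<and>
        (\<forall>v. (\<forall>l<j. \<bar>v \<bullet> b l\<bar> \<le> (C(m := D)) l + 1) \<longrightarrow> \<bar>\<delta> j v\<bar> \<le> (C(m := D)) j)"
      if "j < Suc m" for j
    proof (cases "j = m")
      case True
      then show ?thesis using bound D(1) by simp
    next
      case False
      then have "j < m" using that by simp
      then show ?thesis using C(1)[of j] C(2)[of j] by simp
    qed
    then show ?case by blast
  qed simp
  from this[OF order_refl] obtain C
    where C': "\<forall>j<k. C j \<ge> 0 \<and> (\<forall>v. (\<forall>l<j. \<bar>v \<bullet> b l\<bar> \<le> C l + 1) \<longrightarrow> \<bar>\<delta> j v\<bar> \<le> C j)" ..
  have C: "C j \<ge> 0" "(\<And>l. l < j \<Longrightarrow> \<bar>v \<bullet> b l\<bar> \<le> C l + 1) \<Longrightarrow> \<bar>\<delta> j v\<bar> \<le> C j"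
    if "j < k" for j v
    using C'[rule_format, OF that] by simp_all
  define M where "M = (\<Sum>i<k. (C i + 1) *\<^sub>R b i)"
  have M: "M \<bullet> b j = C j + 1" if "j < k" for j
    unfolding M_def using coord[of "{..<k}" j] that by simp
  have sub: "cbox (-One) One \<subseteq> \<Phi> ` cbox (-M) M"
  proof
    fix y :: 'v assume y: "y \<in> cbox (-One) One"
    have One: "One \<bullet> b j = 1" if "j < k" for j using bB[OF that] by simp
    \<comment> \<open>A fixed point of this map is a solution of \<open>\<Phi> v = y\<close>; the
      displacement bound makes it a self-map of the box.\<close>
    have "v + y - \<Phi> v \<in> cbox (-M) M" if "v \<in> cbox (-M) M" for v
      unfolding box
    proof (intro allI impI)
      fix j assume j: "j < k"
      have "\<bar>\<delta> j v\<bar> \<le> C j"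
        using that j M unfolding box by (intro C(2)) auto
      moreover have "\<bar>y \<bullet> b j\<bar> \<le> 1" using y j One unfolding box by auto
      ultimately show "\<bar>(v + y - \<Phi> v) \<bullet> b j\<bar> \<le> M \<bullet> b j"
        using M[OF j] by (auto simp: \<delta>_def inner_add_left inner_diff_left)
    qed
    moreover have "0 \<in> cbox (-M) M" unfolding box using M C(1) by auto
    moreover have "continuous_on (cbox (-M) M) (\<lambda>v. v + y - \<Phi> v)"
      using continuous_on_subset[OF cont] by (intro continuous_intros) auto
    ultimately obtain v where "v \<in> cbox (-M) M" "v + y - \<Phi> v = v"
      using brouwer[of "cbox (-M) M" "\<lambda>v. v + y - \<Phi> v"] by (auto simp: convex_box)
    then show "y \<in> \<Phi> ` cbox (-M) M" by (intro image_eqI[of _ _ v]) (auto simp: algebra_simps)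
  qed
  have "\<not> negligible (cbox (-One) (One::'v))"
    unfolding negligible_interval using box_ne_empty(2)[of "-One" "One::'v"] by auto
  then have "\<not> negligible (\<Phi> ` cbox (-M) M)" using sub negligible_subset by blast
  then show thesis using that[of "cbox (-M) M"] by simp
qed

subsection \<open>Lie groups acting by formal automorphisms\<close>

locale lie_rep = group G for G :: "('g, 'm) monoid_scheme" (structure) +
  fixes T :: "'g topology" and A :: "('g set \<times> ('g \<Rightarrow> 'e::euclidean_space)) set"
    and n :: nat and \<rho> :: "'g \<Rightarrow> mser \<Rightarrow> mser"
  assumes lie: "lie_group G T A" and hom: "lie_hom_Diff G A n \<rho>" and inj: "inj_on \<rho> (carrier G)"
begin

lemma rho_Diff: "g \<in> carrier G \<Longrightarrow> \<rho> g \<in> Diff n"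
  and rho_mult: "g \<in> carrier G \<Longrightarrow> h \<in> carrier G \<Longrightarrow> \<rho> (g \<otimes> h) f = \<rho> g (\<rho> h f)"
  using hom by (auto simp: lie_hom_Diff_def)

lemma autom_rho: "g \<in> carrier G \<Longrightarrow> autom n (\<rho> g)"
  by (simp add: autom_def rho_Diff)

lemmas rho_PS = autom.PS[OF autom_rho] and rho_agree = autom.agree[OF autom_rho]

text \<open>\<open>\<rho> \<one>\<close> is idempotent and injective on \<open>PS n\<close>.\<close>

lemma rho_one: "f \<in> PS n \<Longrightarrow> \<rho> \<one> f = f"
  using rho_mult[of \<one> \<one> f] rho_Diff[of \<one>] rho_PS[of \<one> f]
  by (auto simp: Diff_def bij_betw_def inj_on_def)

lemma rho_inv: "g \<in> carrier G \<Longrightarrow> f \<in> PS n \<Longrightarrow> \<rho> (inv g) (\<rho> g f) = f"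
  and rho_inv': "g \<in> carrier G \<Longrightarrow> f \<in> PS n \<Longrightarrow> \<rho> g (\<rho> (inv g) f) = f"
  using rho_mult[of "inv g" g f] rho_mult[of g "inv g" f] by (auto simp: rho_one)

section \<open>The kernels of the jet homomorphisms\<close>

definition K :: "nat \<Rightarrow> 'g set" where
  "K p = {g \<in> carrier G. \<forall>f\<in>PS n. agree n p (\<rho> g f) f}"

lemma K_carrier: "g \<in> K p \<Longrightarrow> g \<in> carrier G"
  by (simp add: K_def)

lemma K_antimono: "p \<le> q \<Longrightarrow> K q \<subseteq> K p"
  by (auto simp: K_def intro: agree_mono)

lemma one_K: "\<one> \<in> K p"
  by (simp add: K_def rho_one)

lemma K_diff:
  assumes "g \<in> carrier G" "h \<in> carrier G" "\<And>f. f \<in> PS n \<Longrightarrow> agree n p (\<rho> g f) (\<rho> h f)"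
  shows "inv g \<otimes> h \<in> K p"
  using assms rho_agree[of "inv g" "\<rho> h f" "\<rho> g f" p for f] rho_inv[of g]
  by (auto simp: K_def rho_mult rho_PS agree_sym) (metis agree_sym inv_closed rho_PS rho_agree)

lemma K_diff_K: "g \<in> K p \<Longrightarrow> h \<in> K p \<Longrightarrow> inv g \<otimes> h \<in> K p"
  by (intro K_diff) (auto simp: K_def, meson agree_trans agree_sym)

lemma K_inv: "g \<in> K p \<Longrightarrow> inv g \<in> K p"
  using K_diff_K[of g p \<one>] by (simp add: one_K K_carrier)

lemma K_mult: "g \<in> K p \<Longrightarrow> h \<in> K p \<Longrightarrow> g \<otimes> h \<in> K p"
  using K_diff_K[of "inv g" p h] by (simp add: K_inv K_carrier)

lemma K_conj:
  assumes "d \<in> K p" "g \<in> carrier G" shows "g \<otimes> d \<otimes> inv g \<in> K p"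
proof -
  have "agree n p (\<rho> g (\<rho> d (\<rho> (inv g) f))) (\<rho> g (\<rho> (inv g) f))" if "f \<in> PS n" for f
    using assms that by (intro rho_agree) (auto simp: K_def rho_PS)
  then show ?thesis using assms by (auto simp: K_def rho_mult rho_inv')
qed

lemma K_from_vars:
  assumes "g \<in> carrier G" "\<And>i. i < n \<Longrightarrow> agree n p (\<rho> g (ps_var i)) (ps_var i)"
  shows "g \<in> K p"
proof -
  have "agree n p (\<rho> g (ps_var i)) (\<rho> \<one> (ps_var i))" if "i < n" for i
    using assms(2)[OF that] rho_one[OF PS_var[OF that]] by simp
  then have "agree n p (\<rho> g f) (\<rho> \<one> f)" if "f \<in> PS n" for f
    using Diff_agree_from_vars[OF rho_Diff[OF assms(1)] rho_Diff[OF one_closed]] that by blast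
  then show ?thesis using assms(1) unfolding K_def by (simp add: rho_one)
qed

text \<open>Injectivity of \<open>\<rho>\<close> enters here. Jets of all orders determine the two
  automorphisms on \<open>PS n\<close>, and outside it both are the identity by convention.\<close>

lemma rho_eqI:
  assumes "g \<in> carrier G" "h \<in> carrier G" "\<And>i p. i < n \<Longrightarrow> agree n p (\<rho> g (ps_var i)) (\<rho> h (ps_var i))"
  shows "g = h"
proof -
  have "\<rho> g f = \<rho> h f" for f
  proof (cases "f \<in> PS n")
    case True
    then have "agree n p (\<rho> g f) (\<rho> h f)" for p
      using Diff_agree_from_vars[OF rho_Diff[OF assms(1)] rho_Diff[OF assms(2)] assms(3)] by blast
    then show ?thesis using rho_PS assms(1,2) True by (intro PS_eqI[of _ n]) blast+
  next
    case False
    then show ?thesis using rho_Diff assms(1,2) by (auto simp: Diff_def)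
  qed
  then have "\<rho> g = \<rho> h" by (rule ext)
  then show ?thesis using inj assms(1,2) by (auto simp: inj_on_def)
qed

lemma Inter_K:
  assumes "\<And>p. g \<in> K p" shows "g = \<one>"
proof (rule rho_eqI)
  show "agree n p (\<rho> g (ps_var i)) (\<rho> \<one> (ps_var i))" if "i < n" for i p
    using assms[of p] PS_var[OF that] by (simp add: K_def rho_one)
qed (use assms[of 0] in \<open>auto simp: K_def\<close>)

text \<open>The condition \<open>p \<ge> 1\<close> puts the variables into
  \<open>jet_space n p\<close>, where \<open>jet\<close> really applies the automorphism instead of
  returning its argument; the variables then determine the whole jet.\<close>

lemma jet_separates:
  assumes "K p = {\<one>}" "p \<ge> 1" "g \<in> carrier G" "h \<in> carrier G" "jet n p (\<rho> g) = jet n p (\<rho> h)"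
  shows "g = h"
proof -
  have "agree n p (\<rho> g (ps_var i)) (\<rho> h (ps_var i))" if "i < n" for i
  proof -
    have "mdeg n (\<lambda>j. if j = i then 1 else 0) = 1" using that by (simp add: mdeg_def)
    then have "ps_var i \<in> jet_space n p"
      using that assms(2) PS_var[OF that] by (auto simp: jet_space_def ps_var_def)
    then have "trunc n p (\<rho> g (ps_var i)) = trunc n p (\<rho> h (ps_var i))"
      using fun_cong[OF assms(5), of "ps_var i"] by (simp add: jet_def)
    then show ?thesis by (auto simp: agree_def trunc_def fun_eq_iff split: if_splits)
  qed
  then have "inv g \<otimes> h \<in> K p"
    using assms Diff_agree_from_vars[OF rho_Diff rho_Diff] by (intro K_diff) auto
  then have "inv g \<otimes> h = \<one>" using assms(1) by simp
  then show ?thesis using inv_solve_left[of \<one> g h] assms(3,4) by simp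
qed

section \<open>Continuity of the group operations\<close>

lemma topspace_T: "topspace T = carrier G"
  using lie by (simp add: lie_group_def)

lemma continuous_map_carrier: "continuous_map X T f \<Longrightarrow> x \<in> topspace X \<Longrightarrow> f x \<in> carrier G"
  using continuous_map_funspace topspace_T by fastforce

lemma continuous_map_mult:
  assumes "continuous_map X T f" "continuous_map X T g"
  shows "continuous_map X T (\<lambda>x. f x \<otimes> g x)"
proof -
  have "continuous_map (prod_topology T T) T (\<lambda>(x, y). x \<otimes> y)"
    using lie by (simp add: lie_group_def)
  moreover have "continuous_map X (prod_topology T T) (\<lambda>x. (f x, g x))"
    using assms by (simp add: continuous_map_pairedI)
  ultimately show ?thesis
    using continuous_map_compose[of X "prod_topology T T" "\<lambda>x. (f x, g x)" T "\<lambda>(x, y). x \<otimes> y"]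
    by (simp add: o_def)
qed

lemma continuous_map_inv:
  assumes "continuous_map X T f" shows "continuous_map X T (\<lambda>x. inv (f x))"
proof -
  have "continuous_map T T (\<lambda>x. inv x)" using lie by (simp add: lie_group_def)
  then show ?thesis using continuous_map_compose[OF assms] by (simp add: o_def)
qed

lemma continuous_map_const_T: "g \<in> carrier G \<Longrightarrow> continuous_map X T (\<lambda>x. g)"
  by (simp add: topspace_T)

lemma left_translate_component:
  assumes "connected_component_of T g h"
  shows "connected_component_of T \<one> (inv g \<otimes> h)"
proof -
  obtain C where C: "connectedin T C" "g \<in> C" "h \<in> C"
    using assms by (auto simp: connected_component_of_def)
  have g: "g \<in> carrier G" using C connectedin_subset_topspace topspace_T by blast
  have "continuous_map T T (\<lambda>x. inv g \<otimes> x)"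
    using g by (intro continuous_map_mult continuous_map_const_T) auto
  then have "connectedin T ((\<lambda>x. inv g \<otimes> x) ` C)" using C(1) connectedin_continuous_map_image by blast
  moreover have "\<one> \<in> (\<lambda>x. inv g \<otimes> x) ` C" using C(2) g by (auto simp: image_iff intro!: bexI[of _ g])
  ultimately show ?thesis using C(3) by (auto simp: connected_component_of_def)
qed

text \<open>The commutator map into a discrete normal subgroup is locally constant.\<close>

lemma discrete_kernel_central:
  assumes S: "openin T S" "K p \<inter> S = {\<one>}" and d: "d \<in> K p"
    and g: "connected_component_of T \<one> g"
  shows "g \<otimes> d = d \<otimes> g"
proof -
  obtain C where C: "connectedin T C" "\<one> \<in> C" "g \<in> C"
    using g by (auto simp: connected_component_of_def)
  have CG: "C \<subseteq> carrier G" using C connectedin_subset_topspace topspace_T by blast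
  have dG: "d \<in> carrier G" using d K_carrier by blast
  define c where "c = (\<lambda>x. x \<otimes> d \<otimes> inv x \<otimes> inv d)"
  have cont: "continuous_map T T c" unfolding c_def using dG
    by (intro continuous_map_mult continuous_map_inv continuous_map_const_T continuous_map_id[unfolded id_def]) auto
  have cK: "c x \<in> K p" if "x \<in> carrier G" for x
    unfolding c_def using K_mult[OF K_conj[OF d that] K_inv[OF d]] .
  \<comment> \<open>All commutators \<open>c x\<close> lie in \<open>K p\<close>, so membership in
    \<open>S\<close> means being the unit. The set is open through the first description and closed,
    by the Hausdorff property, through the second.\<close>
  have eq: "{x \<in> topspace T. c x \<in> S} = {x \<in> topspace T. c x \<in> {\<one>}}"
    using cK S(2) by (auto simp: topspace_T)
  have "openin T {x \<in> topspace T. c x \<in> S}" by (rule openin_continuous_map_preimage[OF cont S(1)])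
  moreover have "closedin T {x \<in> topspace T. c x \<in> {\<one>}}"
  proof (rule closedin_continuous_map_preimage[OF cont])
    have "Hausdorff_space T" using lie by (simp add: lie_group_def)
    then show "closedin T {\<one>}" by (simp add: topspace_T closedin_Hausdorff_singleton)
  qed
  ultimately have "C \<subseteq> {x \<in> topspace T. c x \<in> S} \<or> disjnt C {x \<in> topspace T. c x \<in> S}"
    using connectedin_clopen_cases[OF C(1)] eq by simp
  moreover have "c \<one> = \<one>" using dG by (simp add: c_def)
  ultimately have "c g = \<one>"
    unfolding eq using C CG by (auto simp: disjnt_iff topspace_T)
  moreover have gG: "g \<in> carrier G" using C(3) CG by blast
  ultimately have "g \<otimes> d \<otimes> inv g = d"
    using inv_solve_right[of \<one> "g \<otimes> d \<otimes> inv g" d] dG by (simp add: c_def)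
  then show ?thesis using inv_solve_right[of d "g \<otimes> d" g] dG gG by simp
qed

text \<open>Extends a path from the unit to \<open>d\<close> over the real line so that adding one
  to the parameter multiplies by \<open>d\<close> on the right. At an integer the two neighbouring
  pieces match because \<open>\<gamma> 1 = d\<close> and \<open>\<gamma> 0 = \<one>\<close>, and the
  unit intervals form a locally finite closed cover.\<close>

lemma quasiperiodic_path:
  assumes \<gamma>: "pathin T \<gamma>" "\<gamma> 0 = \<one>" "\<gamma> 1 = d"
  shows "continuous_map euclideanreal T (\<lambda>t. \<gamma> (frac t) \<otimes> d [^] \<lfloor>t\<rfloor>)"
proof -
  have c\<gamma>: "continuous_map (top_of_set {0..1}) T \<gamma>" using \<gamma>(1) by (simp add: pathin_def)
  have dG: "d \<in> carrier G" using continuous_map_carrier[OF c\<gamma>, of 1] \<gamma>(3) by simp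
  let ?f = "\<lambda>m t. \<gamma> (t - of_int m) \<otimes> d [^] (m::int)"
  show ?thesis
  proof (rule pasting_lemma_locally_finite[where I = UNIV and T = "\<lambda>m. {of_int m..of_int m + 1}" and f = ?f])
    fix x :: real
    have "{i \<in> UNIV. {real_of_int i..real_of_int i + 1} \<inter> ball x 1 \<noteq> {}} \<subseteq> {\<lfloor>x\<rfloor> - 3..\<lfloor>x\<rfloor> + 3}"
    proof
      fix i assume "i \<in> {i \<in> UNIV. {real_of_int i..real_of_int i + 1} \<inter> ball x 1 \<noteq> {}}"
      then obtain y where "y \<in> ball x 1" "y \<in> {real_of_int i..real_of_int i + 1}" by blast
      then have "\<bar>x - y\<bar> < 1" "real_of_int i \<le> y" "y \<le> real_of_int i + 1" by (auto simp: dist_real_def)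
      then show "i \<in> {\<lfloor>x\<rfloor> - 3..\<lfloor>x\<rfloor> + 3}" by simp linarith
    qed
    then have "finite {i \<in> UNIV. {real_of_int i..real_of_int i + 1} \<inter> ball x 1 \<noteq> {}}"
      by (rule finite_subset) simp
    then show "\<exists>V. openin euclideanreal V \<and> x \<in> V \<and>
        finite {i \<in> UNIV. {real_of_int i..real_of_int i + 1} \<inter> V \<noteq> {}}"
      by (intro exI[of _ "ball x 1"]) auto
  next
    fix m :: int
    show "closedin euclideanreal {real_of_int m..real_of_int m + 1}" by simp
    have "continuous_map (top_of_set {real_of_int m..real_of_int m + 1}) (top_of_set {0..1}) (\<lambda>t. t - of_int m)"
      by (auto intro!: continuous_intros)
    from continuous_map_compose[OF this c\<gamma>]
    show "continuous_map (top_of_set {real_of_int m..real_of_int m + 1}) T (?f m)"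
      using dG by (intro continuous_map_mult continuous_map_const_T) (auto simp: o_def)
  next
    fix i j :: int and x :: real
    assume "x \<in> topspace euclideanreal \<inter> {real_of_int i..real_of_int i + 1} \<inter> {real_of_int j..real_of_int j + 1}"
    then have "i = j \<or> (j = i + 1 \<and> x = of_int i + 1) \<or> (i = j + 1 \<and> x = of_int j + 1)" by auto
    then show "?f i x = ?f j x"
      using dG \<gamma> by (auto simp: int_pow_mult add.commute)
  next
    fix x :: real
    show "\<exists>j. j \<in> UNIV \<and> x \<in> {real_of_int j..real_of_int j + 1} \<and> \<gamma> (frac x) \<otimes> d [^] \<lfloor>x\<rfloor> = ?f j x"
      by (intro exI[of _ "\<lfloor>x\<rfloor>"]) (auto simp: frac_def)
  qed
qed

end

subsection \<open>Differentiability in charts\<close>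

lemma locally_path_connected_space_euclidean:
  "locally_path_connected_space (euclidean :: 'a::real_normed_vector topology)"
  unfolding locally_path_connected_space
proof (intro allI impI)
  fix V :: "'a set" and x assume "openin euclidean V \<and> x \<in> V"
  then obtain r where "r > 0" "ball x r \<subseteq> V" by (auto simp: open_contains_ball)
  then show "\<exists>U. openin euclidean U \<and> path_connectedin euclidean U \<and> x \<in> U \<and> U \<subseteq> V"
    by (intro exI[of _ "ball x r"]) (auto simp: convex_imp_path_connected)
qed

locale charted_lie_rep = lie_rep G T A n \<rho>
  for G :: "('g, 'm) monoid_scheme" (structure) and T
    and A :: "('g set \<times> ('g \<Rightarrow> 'e::euclidean_space)) set" and n \<rho> +
  assumes cover: "\<Union>(fst ` A) = carrier G"
begin

text \<open>The carrier contains the unit, so a covering atlas is nonempty; this excludes the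
  alternative \<open>A = {}\<close> in \<open>lie_group\<close>.\<close>

lemma atlas:
  shows chart: "(U, \<phi>) \<in> A \<Longrightarrow> openin T U \<and> open (\<phi> ` U) \<and>
      homeomorphic_map (subtopology T U) (top_of_set (\<phi> ` U)) \<phi>"
    and smooth_mult: "(U, \<phi>) \<in> A \<Longrightarrow> (V, \<psi>) \<in> A \<Longrightarrow> (W, \<theta>) \<in> A \<Longrightarrow>
      smooth_on {(a, b). a \<in> \<phi> ` U \<and> b \<in> \<psi> ` V \<and> inv_into U \<phi> a \<otimes> inv_into V \<psi> b \<in> W}
        (\<lambda>(a, b). \<theta> (inv_into U \<phi> a \<otimes> inv_into V \<psi> b))"
    and smooth_inv: "(U, \<phi>) \<in> A \<Longrightarrow> (V, \<psi>) \<in> A \<Longrightarrow>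
      smooth_on {a \<in> \<phi> ` U. inv (inv_into U \<phi> a) \<in> V} (\<lambda>a. \<psi> (inv (inv_into U \<phi> a)))"
proof -
  have "A \<noteq> {}" using cover by auto
  then have 1: "\<forall>(U, \<phi>)\<in>A. openin T U \<and> open (\<phi> ` U) \<and>
            homeomorphic_map (subtopology T U) (top_of_set (\<phi> ` U)) \<phi>"
    and 2: "\<forall>(U, \<phi>)\<in>A. \<forall>(V, \<psi>)\<in>A. \<forall>(W, \<theta>)\<in>A.
            smooth_on {(a, b). a \<in> \<phi> ` U \<and> b \<in> \<psi> ` V \<and> inv_into U \<phi> a \<otimes> inv_into V \<psi> b \<in> W}
              (\<lambda>(a, b). \<theta> (inv_into U \<phi> a \<otimes> inv_into V \<psi> b))"
    and 3: "\<forall>(U, \<phi>)\<in>A. \<forall>(V, \<psi>)\<in>A.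
            smooth_on {a \<in> \<phi> ` U. inv (inv_into U \<phi> a) \<in> V} (\<lambda>a. \<psi> (inv (inv_into U \<phi> a)))"
    using lie unfolding lie_group_def by argo+
  show "openin T U \<and> open (\<phi> ` U) \<and>
      homeomorphic_map (subtopology T U) (top_of_set (\<phi> ` U)) \<phi>" if "(U, \<phi>) \<in> A"
    using bspec[OF 1 that] unfolding prod.case .
  show "smooth_on {(a, b). a \<in> \<phi> ` U \<and> b \<in> \<psi> ` V \<and> inv_into U \<phi> a \<otimes> inv_into V \<psi> b \<in> W}
        (\<lambda>(a, b). \<theta> (inv_into U \<phi> a \<otimes> inv_into V \<psi> b))"
    if "(U, \<phi>) \<in> A" "(V, \<psi>) \<in> A" "(W, \<theta>) \<in> A"
    using bspec[OF bspec[OF bspec[OF 2 that(1), unfolded prod.case] that(2), unfolded prod.case] that(3)]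
    unfolding prod.case .
  show "smooth_on {a \<in> \<phi> ` U. inv (inv_into U \<phi> a) \<in> V} (\<lambda>a. \<psi> (inv (inv_into U \<phi> a)))"
    if "(U, \<phi>) \<in> A" "(V, \<psi>) \<in> A"
    using bspec[OF bspec[OF 3 that(1), unfolded prod.case] that(2)] unfolding prod.case .
qed

lemma chart_at:
  assumes "g \<in> carrier G" obtains U \<phi> where "(U, \<phi>) \<in> A" "g \<in> U"
proof -
  obtain c where "c \<in> A" "g \<in> fst c" using assms cover by blast
  then show thesis using that[of "fst c" "snd c"] by simp
qed

lemma smooth_on_C1: "smooth_on S f \<Longrightarrow> Ck_on 1 S f"
  unfolding smooth_on_def by blast

lemma smooth_on_differentiable: "smooth_on S f \<Longrightarrow> f differentiable_on S"
  using smooth_on_C1[of S f] by simp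

context
  fixes U \<phi> assumes UA: "(U, \<phi>) \<in> A"
begin

lemma chart_open: "openin T U" and chart_open_range: "open (\<phi> ` U)"
  and chart_homeo: "homeomorphic_map (subtopology T U) (top_of_set (\<phi> ` U)) \<phi>"
  using chart[OF UA] by auto

lemma chart_carrier: "U \<subseteq> carrier G"
  using chart_open openin_subset topspace_T by blast

lemma chart_inv: "x \<in> U \<Longrightarrow> inv_into U \<phi> (\<phi> x) = x"
  using homeomorphic_imp_injective_map[OF chart_homeo] chart_carrier
  by (simp add: topspace_T inf_absorb2)

lemma chart_inv_mem: "a \<in> \<phi> ` U \<Longrightarrow> inv_into U \<phi> a \<in> U"
  and chart_inv_carrier: "a \<in> \<phi> ` U \<Longrightarrow> inv_into U \<phi> a \<in> carrier G"
  and chart_inv_right: "a \<in> \<phi> ` U \<Longrightarrow> \<phi> (inv_into U \<phi> a) = a"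
  using chart_carrier by (auto simp: inv_into_into f_inv_into_f)

lemma chart_continuous: "continuous_map (subtopology T U) euclidean \<phi>"
  using homeomorphic_imp_continuous_map[OF chart_homeo] continuous_map_into_fulltopology by blast

lemma chart_open_preimage:
  assumes "openin T S" shows "open {a \<in> \<phi> ` U. inv_into U \<phi> a \<in> S}"
proof -
  have "openin (subtopology T U) (U \<inter> S)"
    using assms by (auto simp: openin_subtopology)
  then have "openin (top_of_set (\<phi> ` U)) (\<phi> ` (U \<inter> S))"
    using homeomorphic_imp_open_map[OF chart_homeo] by (simp add: open_map_def)
  then have "open (\<phi> ` (U \<inter> S))"
    using chart_open_range openin_open_trans by blast
  moreover have "\<phi> ` (U \<inter> S) = {a \<in> \<phi> ` U. inv_into U \<phi> a \<in> S}"
    by (auto simp: chart_inv)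
  ultimately show ?thesis by simp
qed

end

text \<open>Charts carry the property over from open sets of the model space. It later turns
  membership in the identity component into an actual path from the unit.\<close>

lemma locally_path_connected: "locally_path_connected_space T"
  unfolding locally_path_connected_space
proof (intro allI impI)
  fix V x assume V: "openin T V \<and> x \<in> V"
  then have "x \<in> carrier G" using openin_subset topspace_T by blast
  then obtain U \<phi> where U: "(U, \<phi>) \<in> A" "x \<in> U" by (rule chart_at)
  have "locally_path_connected_space (top_of_set (\<phi> ` U))"
    using locally_path_connected_space_open_subset[OF locally_path_connected_space_euclidean]
      chart_open_range[OF U(1)] by simp
  then have "locally_path_connected_space (subtopology T U)"
    using homeomorphic_locally_path_connected_space homeomorphic_map_imp_homeomorphic_space
      chart_homeo[OF U(1)] by blast
  moreover have "openin (subtopology T U) (U \<inter> V)" "x \<in> U \<inter> V"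
    using V U by (auto simp: openin_subtopology)
  ultimately obtain W where W: "openin (subtopology T U) W" "path_connectedin (subtopology T U) W"
    "x \<in> W" "W \<subseteq> U \<inter> V"
    unfolding locally_path_connected_space by meson
  then have "openin T W \<and> path_connectedin T W \<and> x \<in> W \<and> W \<subseteq> V"
    using chart_open[OF U(1)] by (auto simp: openin_open_subtopology path_connectedin_subtopology)
  then show "\<exists>U. openin T U \<and> path_connectedin T U \<and> x \<in> U \<and> U \<subseteq> V" by blast
qed

text \<open>Differentiability in every chart, without continuity of the derivative: this is all that
  the dimension argument uses, and it is stable under sums, products and composition with
  inversion.\<close>

definition dfun :: "('g \<Rightarrow> 'b::real_normed_vector) \<Rightarrow> bool" where
  "dfun u \<longleftrightarrow> (\<forall>(U, \<phi>)\<in>A. \<forall>a\<in>\<phi> ` U. (\<lambda>a. u (inv_into U \<phi> a)) differentiable (at a))"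

lemma dfunD: "dfun u \<Longrightarrow> (U, \<phi>) \<in> A \<Longrightarrow> a \<in> \<phi> ` U \<Longrightarrow> (\<lambda>a. u (inv_into U \<phi> a)) differentiable (at a)"
  by (auto simp: dfun_def)

lemma dfun_const: "dfun (\<lambda>_. c)"
  by (simp add: dfun_def)

lemma dfun_mult: "dfun u \<Longrightarrow> dfun v \<Longrightarrow> dfun (\<lambda>g. u g * v g :: 'b::real_normed_algebra)"
  unfolding dfun_def by (auto intro!: differentiable_mult)

lemma dfun_add: "dfun u \<Longrightarrow> dfun v \<Longrightarrow> dfun (\<lambda>g. u g + v g)"
  unfolding dfun_def by (auto intro!: differentiable_add)

lemma dfun_sum: "(\<And>i. i \<in> I \<Longrightarrow> dfun (u i)) \<Longrightarrow> dfun (\<lambda>g. \<Sum>i\<in>I. u i g)"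
  by (induction I rule: infinite_finite_induct) (auto intro: dfun_const dfun_add)

lemma dfun_linear:
  assumes "dfun u" "bounded_linear L" shows "dfun (\<lambda>g. L (u g))"
  unfolding dfun_def
proof clarify
  fix U \<phi> x assume "(U, \<phi>) \<in> A" "x \<in> U"
  then obtain D where "((\<lambda>a. u (inv_into U \<phi> a)) has_derivative D) (at (\<phi> x))"
    using dfunD[OF assms(1)] by (force simp: differentiable_def)
  from bounded_linear.has_derivative[OF assms(2) this]
  show "(\<lambda>a. L (u (inv_into U \<phi> a))) differentiable (at (\<phi> x))" by (auto simp: differentiable_def)
qed

lemma dfun_cong:
  assumes u: "dfun u" and eq: "\<And>g. g \<in> carrier G \<Longrightarrow> u g = v g" shows "dfun v"
  unfolding dfun_def
proof clarify
  fix U \<phi> x assume U: "(U, \<phi>) \<in> A" and x: "x \<in> U"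
  have "(\<lambda>a. u (inv_into U \<phi> a)) differentiable (at (\<phi> x))"
    using u U x by (auto simp: dfun_def)
  then obtain D where "((\<lambda>a. u (inv_into U \<phi> a)) has_derivative D) (at (\<phi> x))"
    by (auto simp: differentiable_def)
  then have "((\<lambda>a. v (inv_into U \<phi> a)) has_derivative D) (at (\<phi> x))"
    by (rule has_derivative_transform_within_open[OF _ chart_open_range[OF U]])
       (use x eq chart_inv_carrier[OF U] in auto)
  then show "(\<lambda>a. v (inv_into U \<phi> a)) differentiable (at (\<phi> x))" by (auto simp: differentiable_def)
qed

lemma dfun_inverse:
  assumes u: "dfun u" shows "dfun (\<lambda>g. u (inv g))"
  unfolding dfun_def
proof (clarify)
  fix U \<phi> x assume U: "(U, \<phi>) \<in> A" and x: "x \<in> U"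
  have xG: "x \<in> carrier G" using x chart_carrier[OF U] by blast
  obtain V \<psi> where V: "(V, \<psi>) \<in> A" "inv x \<in> V" using chart_at[of "inv x"] xG by auto
  let ?S = "{a \<in> \<phi> ` U. inv (inv_into U \<phi> a) \<in> V}" and ?h = "\<lambda>a. \<psi> (inv (inv_into U \<phi> a))"
  have "openin T {y \<in> topspace T. inv y \<in> V}"
    using openin_continuous_map_preimage[OF continuous_map_inv[OF continuous_map_id[of T, unfolded id_def]]]
      chart_open[OF V(1)] by simp
  then have "open {a \<in> \<phi> ` U. inv_into U \<phi> a \<in> {y \<in> topspace T. inv y \<in> V}}"
    by (rule chart_open_preimage[OF U])
  moreover have "{a \<in> \<phi> ` U. inv_into U \<phi> a \<in> {y \<in> topspace T. inv y \<in> V}} = ?S"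
    using chart_inv_carrier[OF U] by (auto simp: topspace_T)
  ultimately have S: "open ?S" by simp
  have xS: "\<phi> x \<in> ?S" using x V chart_inv[OF U] by simp
  have "?h differentiable (at (\<phi> x))"
    using smooth_on_differentiable[OF smooth_inv[OF U V(1)]] S xS
    by (simp add: differentiable_on_eq_differentiable_at)
  moreover have "(\<lambda>b. u (inv_into V \<psi> b)) differentiable (at (?h (\<phi> x)))"
    using u V x chart_inv[OF U] by (intro dfunD) auto
  ultimately have "((\<lambda>b. u (inv_into V \<psi> b)) \<circ> ?h) differentiable (at (\<phi> x))"
    by (rule differentiable_chain_at)
  then obtain D where "(((\<lambda>b. u (inv_into V \<psi> b)) \<circ> ?h) has_derivative D) (at (\<phi> x))"
    by (auto simp: differentiable_def)
  then have "((\<lambda>a. u (inv (inv_into U \<phi> a))) has_derivative D) (at (\<phi> x))"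
    by (rule has_derivative_transform_within_open[OF _ S xS]) (simp add: chart_inv[OF V(1)])
  then show "(\<lambda>a. u (inv (inv_into U \<phi> a))) differentiable (at (\<phi> x))" by (auto simp: differentiable_def)
qed

lemma dfun_continuous:
  assumes u: "dfun u" shows "continuous_map T euclidean u"
proof (rule pasting_lemma[where I = A and T = fst and f = "\<lambda>_. u"])
  fix c assume c: "c \<in> A"
  obtain U \<phi> where U: "c = (U, \<phi>)" "(U, \<phi>) \<in> A" using c by (cases c) auto
  show "openin T (fst c)" using U chart_open by auto
  have "continuous_on (\<phi> ` U) (\<lambda>a. u (inv_into U \<phi> a))"
    using dfunD[OF u U(2)] by (intro differentiable_imp_continuous_on)
      (auto simp: differentiable_on_def intro: differentiable_at_withinI)
  then have "continuous_map (top_of_set (\<phi> ` U)) euclidean (\<lambda>a. u (inv_into U \<phi> a))" by simp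
  from continuous_map_compose[OF homeomorphic_imp_continuous_map[OF chart_homeo[OF U(2)]] this]
  have "continuous_map (subtopology T U) euclidean (\<lambda>x. u (inv_into U \<phi> (\<phi> x)))" by (simp add: o_def)
  then have "continuous_map (subtopology T U) euclidean u"
    by (rule continuous_map_eq) (auto simp: chart_inv[OF U(2)])
  then show "continuous_map (subtopology T (fst c)) euclidean u" using U by simp
next
  fix x assume "x \<in> topspace T"
  then obtain U \<phi> where "(U, \<phi>) \<in> A" "x \<in> U" unfolding topspace_T by (rule chart_at)
  then show "\<exists>j. j \<in> A \<and> x \<in> fst j \<and> u x = u x" by (intro exI[of _ "(U, \<phi>)"]) simp
qed simp

lemma coordinate_C1:
  assumes "i < n" "\<alpha> \<in> mi n" "(U, \<phi>) \<in> A"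
  shows "Ck_on 1 (\<phi> ` U) (\<lambda>a. \<rho> (inv_into U \<phi> a) (ps_var i) \<alpha>)"
proof -
  \<comment> \<open>The order is at least \<open>mdeg n \<alpha>\<close>, so that truncation keeps
    the coefficient, and at least one, so that the variable belongs to the jet space.\<close>
  let ?p = "max 1 (mdeg n \<alpha>)"
  have "mdeg n (\<lambda>j. if j = i then 1 else 0) = 1" using assms(1) by (simp add: mdeg_def)
  then have "ps_var i \<in> jet_space n ?p"
    using PS_var[OF assms(1)] by (auto simp: jet_space_def ps_var_def)
  then have "jet n ?p \<Phi> (ps_var i) \<alpha> = \<Phi> (ps_var i) \<alpha>" for \<Phi>
    by (simp add: jet_def trunc_def)
  moreover have "smooth_on (\<phi> ` U) (\<lambda>a. jet n ?p (\<rho> (inv_into U \<phi> a)) (ps_var i) \<alpha>)"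
  proof -
    have "\<forall>p. \<forall>(U, \<phi>)\<in>A. \<forall>i<n. \<forall>\<alpha>\<in>mi n. mdeg n \<alpha> \<le> p \<longrightarrow>
         smooth_on (\<phi> ` U) (\<lambda>a. jet n p (\<rho> (inv_into U \<phi> a)) (ps_var i) \<alpha>)"
      using hom unfolding lie_hom_Diff_def by blast
    from bspec[OF spec[OF this] assms(3), unfolded prod.case, rule_format, OF assms(1,2)]
    show ?thesis by simp
  qed
  ultimately have "smooth_on (\<phi> ` U) (\<lambda>a. \<rho> (inv_into U \<phi> a) (ps_var i) \<alpha>)" by simp
  then show ?thesis by (rule smooth_on_C1)
qed

lemma dfun_var:
  assumes "i < n" "\<alpha> \<in> mi n" shows "dfun (\<lambda>g. \<rho> g (ps_var i) \<alpha>)"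
  unfolding dfun_def
proof clarify
  fix U \<phi> x assume U: "(U, \<phi>) \<in> A" "x \<in> U"
  show "(\<lambda>a. \<rho> (inv_into U \<phi> a) (ps_var i) \<alpha>) differentiable (at (\<phi> x))"
    using coordinate_C1[OF assms U(1)] chart_open_range[OF U(1)] U(2)
    by (auto simp: differentiable_on_eq_differentiable_at)
qed

text \<open>Induction on the degree of \<open>\<alpha>\<close>: the coefficient is a polynomial
  expression in coefficients of images of variables and of images of the quotients
  \<open>h i\<close>. Terms with \<open>\<beta>\<close> of degree zero vanish, so the quotients
  contribute only coefficients of smaller degree.\<close>

lemma dfun_coeff: "f \<in> PS n \<Longrightarrow> \<alpha> \<in> mi n \<Longrightarrow> dfun (\<lambda>g. \<rho> g f \<alpha>)"
proof (induction "mdeg n \<alpha>" arbitrary: f \<alpha> rule: less_induct)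
  case less
  obtain h where h: "\<And>i. i < n \<Longrightarrow> h i \<in> PS n"
    "f = ps_add (ps_scale (f (\<lambda>_. 0)) ps_one) (\<lambda>\<alpha>. \<Sum>i<n. ps_mult (ps_var i) (h i) \<alpha>)"
    using PS_decompose[OF less.prems(1)] by metis
  let ?B = "{\<beta>. \<forall>i. \<beta> i \<le> \<alpha> i}"
  have "dfun (\<lambda>g. f (\<lambda>_. 0) * ps_one \<alpha> +
      (\<Sum>i<n. \<Sum>\<beta>\<in>?B. \<rho> g (ps_var i) \<beta> * \<rho> g (h i) (\<lambda>j. \<alpha> j - \<beta> j)))"
  proof (intro dfun_add dfun_const dfun_sum)
    fix i \<beta> assume "i \<in> {..<n}" and "\<beta> \<in> ?B"
    then have i: "i < n" and \<beta>: "\<And>j. \<beta> j \<le> \<alpha> j" by auto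
    note mi = mi_diff[OF less.prems(2) \<beta>] and deg = mdeg_diff[of \<beta> \<alpha> n, OF \<beta>]
    show "dfun (\<lambda>g. \<rho> g (ps_var i) \<beta> * \<rho> g (h i) (\<lambda>j. \<alpha> j - \<beta> j))"
    proof (cases "mdeg n \<beta> = 0")
      case True
      then have "\<rho> g (ps_var i) \<beta> = 0" if "g \<in> carrier G" for g
        using autom.var_vanish[OF autom_rho[OF that] i] mi by (auto simp: agree_def)
      then show ?thesis by (intro dfun_cong[OF dfun_const[of 0]]) simp
    next
      case False
      then have "dfun (\<lambda>g. \<rho> g (h i) (\<lambda>j. \<alpha> j - \<beta> j))"
        using deg mi by (intro less.hyps h(1) i) auto
      then show ?thesis using mi i by (intro dfun_mult dfun_var) auto
    qed
  qed
  then show ?case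
  proof (rule dfun_cong)
    fix g assume g: "g \<in> carrier G"
    have "\<rho> g f = ps_add (ps_scale (f (\<lambda>_. 0)) ps_one)
        (\<lambda>\<alpha>. \<Sum>i<n. ps_mult (\<rho> g (ps_var i)) (\<rho> g (h i)) \<alpha>)"
      by (rule autom.PS_decompose_image[OF autom_rho[OF g] h(1) h(2)])
    from fun_cong[OF this, of \<alpha>]
    show "f (\<lambda>_. 0) * ps_one \<alpha> + (\<Sum>i<n. \<Sum>\<beta>\<in>?B. \<rho> g (ps_var i) \<beta> * \<rho> g (h i) (\<lambda>j. \<alpha> j - \<beta> j)) = \<rho> g f \<alpha>"
      by (simp add: ps_add_def ps_scale_def ps_mult_def)
  qed
qed

end

subsection \<open>Discreteness of the kernels\<close>

context charted_lie_rep
begin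

context
  fixes U \<phi> assumes UA: "(U, \<phi>) \<in> A"
begin

abbreviation coords :: "nat \<times> (nat \<Rightarrow> nat) \<Rightarrow> 'e \<Rightarrow> complex" where
  "coords \<equiv> \<lambda>c a. \<rho> (inv_into U \<phi> a) (ps_var (fst c)) (snd c)"

abbreviation coord_index :: "nat \<Rightarrow> (nat \<times> (nat \<Rightarrow> nat)) set" where
  "coord_index p \<equiv> {..<n} \<times> mi_le n p"

lemma coords_differentiable:
  assumes "c \<in> coord_index p" "a \<in> \<phi> ` U"
  shows "coords c differentiable (at a)"
proof -
  have "dfun (\<lambda>g. \<rho> g (ps_var (fst c)) (snd c))"
    using assms(1) by (intro dfun_var) (auto simp: mi_le_def)
  then show ?thesis using dfunD[OF _ UA assms(2)] by blast
qed

text \<open>Left translation is the restriction of the multiplication, smooth in two arguments, to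
  the slice through the chart image of \<open>k\<close>.\<close>

lemma translation_differentiable:
  assumes k: "k \<in> carrier G" and b: "b \<in> \<phi> ` U" "k \<otimes> inv_into U \<phi> b \<in> U"
  shows "(\<lambda>b. \<phi> (k \<otimes> inv_into U \<phi> b)) differentiable (at b)"
    and "open {b \<in> \<phi> ` U. k \<otimes> inv_into U \<phi> b \<in> U}"
proof -
  obtain V \<psi> where V: "(V, \<psi>) \<in> A" "k \<in> V" using k by (rule chart_at)
  let ?S = "{b \<in> \<phi> ` U. k \<otimes> inv_into U \<phi> b \<in> U}"
  let ?P = "{(a, b). a \<in> \<psi> ` V \<and> b \<in> \<phi> ` U \<and> inv_into V \<psi> a \<otimes> inv_into U \<phi> b \<in> U}"
  have "continuous_map T T (\<lambda>x. k \<otimes> x)"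
    using k by (intro continuous_map_mult continuous_map_const_T continuous_map_id[unfolded id_def]) auto
  then have "openin T {x \<in> topspace T. k \<otimes> x \<in> U}"
    using openin_continuous_map_preimage chart_open[OF UA] by blast
  from chart_open_preimage[OF UA this]
  have "open {b \<in> \<phi> ` U. inv_into U \<phi> b \<in> {x \<in> topspace T. k \<otimes> x \<in> U}}" .
  moreover have "{b \<in> \<phi> ` U. inv_into U \<phi> b \<in> {x \<in> topspace T. k \<otimes> x \<in> U}} = ?S"
    using chart_inv_carrier[OF UA] by (auto simp: topspace_T)
  ultimately show S: "open ?S" by simp
  have "(\<lambda>b. (\<psi> k, b)) ` ?S \<subseteq> ?P" using V chart_inv[OF V(1)] by auto
  then have "(\<lambda>(a, b). \<phi> (inv_into V \<psi> a \<otimes> inv_into U \<phi> b)) differentiable_on (\<lambda>b. (\<psi> k, b)) ` ?S"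
    using smooth_on_differentiable[OF smooth_mult[OF V(1) UA UA]] differentiable_on_subset by blast
  moreover have "(\<lambda>b. (\<psi> k, b)) differentiable_on ?S"
    by (auto simp: differentiable_on_def differentiable_def intro!: exI derivative_intros)
  ultimately have "(\<lambda>b. (\<lambda>(a, b). \<phi> (inv_into V \<psi> a \<otimes> inv_into U \<phi> b)) (\<psi> k, b)) differentiable_on ?S"
    by (rule differentiable_on_compose[rotated])
  then have "(\<lambda>b. \<phi> (k \<otimes> inv_into U \<phi> b)) differentiable_on ?S"
    by (simp add: chart_inv[OF V(1) V(2)])
  then show "(\<lambda>b. \<phi> (k \<otimes> inv_into U \<phi> b)) differentiable (at b)"
    using S b by (simp add: differentiable_on_eq_differentiable_at)
qed

text \<open>Left translation by \<open>k\<close> acts on the jets by a linear map, so its derivative carries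
  the joint kernel at \<open>g\<close> injectively into the one at \<open>k \<otimes> g\<close>.\<close>

lemma dim_joint_kernel_le:
  assumes g: "g \<in> U" and h: "h \<in> U"
  shows "dim (joint_kernel coords (coord_index p) (\<phi> g)) \<le> dim (joint_kernel coords (coord_index p) (\<phi> h))"
proof -
  have gG: "g \<in> carrier G" and hG: "h \<in> carrier G" using g h chart_carrier[OF UA] by auto
  define k where "k = h \<otimes> inv g"
  have k: "k \<in> carrier G" using gG hG by (simp add: k_def)
  have kg: "k \<otimes> g = h" using gG hG by (simp add: k_def m_assoc)
  have kh: "inv k \<otimes> h = g" using gG hG k inv_solve_left[of g k h] kg by simp
  define \<tau> where "\<tau> = (\<lambda>k b. \<phi> (k \<otimes> inv_into U \<phi> b))"
  have \<tau>g: "\<tau> k (\<phi> g) = \<phi> h" and \<tau>h: "\<tau> (inv k) (\<phi> h) = \<phi> g"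
    using g h kg kh by (auto simp: \<tau>_def chart_inv[OF UA])
  have "\<tau> k differentiable (at (\<phi> g))" "\<tau> (inv k) differentiable (at (\<phi> h))"
    unfolding \<tau>_def using k g h kg kh by (intro translation_differentiable; simp add: chart_inv[OF UA])+
  then obtain D D' where D: "(\<tau> k has_derivative D) (at (\<phi> g))"
    and D': "(\<tau> (inv k) has_derivative D') (at (\<phi> h))" by (auto simp: differentiable_def)
  let ?S = "{b \<in> \<phi> ` U. k \<otimes> inv_into U \<phi> b \<in> U}"
  have S: "open ?S" "\<phi> g \<in> ?S"
    using translation_differentiable(2)[OF k, of "\<phi> g"] g h kg by (auto simp: chart_inv[OF UA])
  have "((\<lambda>b. \<tau> (inv k) (\<tau> k b)) has_derivative (\<lambda>v. D' (D v))) (at (\<phi> g))"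
    using has_derivative_compose[OF D] D' \<tau>g by simp
  moreover have "((\<lambda>b. \<tau> (inv k) (\<tau> k b)) has_derivative (\<lambda>v. v)) (at (\<phi> g))"
  proof (rule has_derivative_transform_within_open[OF has_derivative_ident S])
    fix b assume b: "b \<in> ?S"
    then have "inv_into U \<phi> (\<tau> k b) = k \<otimes> inv_into U \<phi> b" by (auto simp: \<tau>_def chart_inv[OF UA])
    moreover have "inv k \<otimes> (k \<otimes> inv_into U \<phi> b) = inv_into U \<phi> b"
      using b k chart_inv_carrier[OF UA] by (simp add: m_assoc[symmetric])
    ultimately show "b = \<tau> (inv k) (\<tau> k b)"
      using b by (simp add: chart_inv_right[OF UA] \<tau>_def)
  qed
  ultimately have "(\<lambda>v. D' (D v)) = (\<lambda>v. v)" by (rule has_derivative_unique)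
  then have inj: "inj D" by (metis (mono_tags) injI)
  have linD: "linear D" using D by (rule has_derivative_linear)
  have gU: "\<phi> g \<in> \<phi> ` U" and hU: "\<phi> h \<in> \<phi> ` U" using g h by auto
  have "D v \<in> joint_kernel coords (coord_index p) (\<phi> h)"
    if v: "v \<in> joint_kernel coords (coord_index p) (\<phi> g)" for v
    unfolding joint_kernel_def
  proof (intro CollectI ballI)
    fix c' assume "c' \<in> coord_index p"
    then obtain i \<alpha> where i: "i \<in> {..<n}" and \<alpha>: "\<alpha> \<in> mi_le n p" and c': "c' = (i, \<alpha>)" by blast
    have c: "(i, \<alpha>) \<in> coord_index p" using i \<alpha> by simp
    let ?d = "\<lambda>c x. frechet_derivative (coords c) (at x)"
    have d: "(coords c has_derivative ?d c x) (at x)" if "c \<in> coord_index p" "x \<in> \<phi> ` U" for c x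
      using coords_differentiable[OF that] by (simp add: frechet_derivative_works)
    have 1: "((\<lambda>b. coords (i, \<alpha>) (\<tau> k b)) has_derivative (\<lambda>v. ?d (i, \<alpha>) (\<phi> h) (D v))) (at (\<phi> g))"
      using has_derivative_compose[OF D] d[OF c hU] \<tau>g by simp
    have "((\<lambda>b. \<Sum>\<beta>\<in>mi_le n p. coords (i, \<beta>) b * \<rho> k (ps_mono \<beta>) \<alpha>) has_derivative
        (\<lambda>v. \<Sum>\<beta>\<in>mi_le n p. ?d (i, \<beta>) (\<phi> g) v * \<rho> k (ps_mono \<beta>) \<alpha>)) (at (\<phi> g))"
      using d[OF _ gU] i by (intro has_derivative_sum has_derivative_mult_left) auto
    then have "((\<lambda>b. coords (i, \<alpha>) (\<tau> k b)) has_derivative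
        (\<lambda>v. \<Sum>\<beta>\<in>mi_le n p. ?d (i, \<beta>) (\<phi> g) v * \<rho> k (ps_mono \<beta>) \<alpha>)) (at (\<phi> g))"
    proof (rule has_derivative_transform_within_open[OF _ S])
      fix b assume b: "b \<in> ?S"
      have bG: "inv_into U \<phi> b \<in> carrier G" using b chart_inv_carrier[OF UA] by simp
      have "coords (i, \<alpha>) (\<tau> k b) = \<rho> k (\<rho> (inv_into U \<phi> b) (ps_var i)) \<alpha>"
        using b k bG by (simp add: \<tau>_def chart_inv[OF UA] rho_mult)
      also have "\<dots> = (\<Sum>\<beta>\<in>mi_le n p. coords (i, \<beta>) b * \<rho> k (ps_mono \<beta>) \<alpha>)"
        unfolding fst_conv snd_conv
        using i by (intro autom.coeff_expansion[OF autom_rho[OF k] rho_PS[OF bG PS_var] \<alpha>]) simp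
      finally show "(\<Sum>\<beta>\<in>mi_le n p. coords (i, \<beta>) b * \<rho> k (ps_mono \<beta>) \<alpha>) = coords (i, \<alpha>) (\<tau> k b)"
        by (rule sym)
    qed
    \<comment> \<open>One function is differentiated in two ways: by the chain rule through
      \<open>\<tau> k\<close>, and as a linear combination of the jet coordinates, whose derivatives
      at \<open>\<phi> g\<close> all vanish on \<open>v\<close>.\<close>
    from fun_cong[OF has_derivative_unique[OF 1 this], of v]
    have "?d (i, \<alpha>) (\<phi> h) (D v) = (\<Sum>\<beta>\<in>mi_le n p. ?d (i, \<beta>) (\<phi> g) v * \<rho> k (ps_mono \<beta>) \<alpha>)" .
    also have "\<dots> = 0"
    proof (rule sum.neutral, rule ballI)
      fix \<beta> assume "\<beta> \<in> mi_le n p"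
      moreover have "\<forall>c\<in>coord_index p. ?d c (\<phi> g) v = 0"
        using v unfolding joint_kernel_def by (rule CollectD)
      ultimately have "?d (i, \<beta>) (\<phi> g) v = 0" using i by (meson SigmaI)
      then show "?d (i, \<beta>) (\<phi> g) v * \<rho> k (ps_mono \<beta>) \<alpha> = 0" by (simp only: mult_zero_left)
    qed
    finally show "?d c' (\<phi> h) (D v) = 0" unfolding c' .
  qed
  then have sub: "D ` joint_kernel coords (coord_index p) (\<phi> g) \<subseteq> joint_kernel coords (coord_index p) (\<phi> h)"
    by blast
  have "dim (D ` joint_kernel coords (coord_index p) (\<phi> g)) = dim (joint_kernel coords (coord_index p) (\<phi> g))"
    by (rule dim_image_eq[OF linD inj_on_subset[OF inj subset_UNIV]])
  then show ?thesis using dim_subset[OF sub] by simp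
qed

lemma dim_joint_kernel_eq:
  "a \<in> \<phi> ` U \<Longrightarrow> b \<in> \<phi> ` U \<Longrightarrow>
    dim (joint_kernel coords (coord_index p) a) = dim (joint_kernel coords (coord_index p) b)"
  by (auto intro!: antisym dim_joint_kernel_le)

lemma subspace_coord_kernel: "a \<in> \<phi> ` U \<Longrightarrow> subspace (joint_kernel coords (coord_index p) a)"
  using coords_differentiable by (intro subspace_joint_kernel) blast

lemma coord_kernel_antimono:
  "p \<le> q \<Longrightarrow> joint_kernel coords (coord_index q) a \<subseteq> joint_kernel coords (coord_index p) a"
  by (fastforce simp: joint_kernel_def mi_le_def)

text \<open>If the stable joint kernel were nonzero, a curve tangent to it would have constant jets of all
  orders.\<close>

lemma kernel_discrete_at_chart:
  assumes one: "\<one> \<in> U"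
  shows "\<exists>p\<ge>1. \<exists>S. openin T S \<and> K p \<inter> S = {\<one>}"
proof -
  let ?J = "\<lambda>p. joint_kernel coords (coord_index p)" and ?a = "\<phi> \<one>"
  have aU: "?a \<in> \<phi> ` U" using one by simp
  \<comment> \<open>An order of least kernel dimension. As the kernels are nested, minimality forces
    equality for every larger order.\<close>
  obtain p where p: "1 \<le> p" "\<And>q. 1 \<le> q \<Longrightarrow> dim (?J p ?a) \<le> dim (?J q ?a)"
    using ex_has_least_nat[of "\<lambda>p. 1 \<le> p" 1 "\<lambda>p. dim (?J p ?a)"] by blast
  have stable: "?J q x = ?J p x" if "p \<le> q" "x \<in> \<phi> ` U" for q x
  proof (rule subspace_dim_equal[OF subspace_coord_kernel[OF that(2)] subspace_coord_kernel[OF that(2)]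
        coord_kernel_antimono[OF that(1)]])
    show "dim (?J p x) \<le> dim (?J q x)"
      using p(2)[of q] that p(1) dim_joint_kernel_eq[OF that(2) aU] by simp
  qed
  have C1: "Ck_on 1 (\<phi> ` U) (coords c)" if "c \<in> coord_index p" for c
    using that by (intro coordinate_C1[OF _ _ UA]) (auto simp: mi_le_def)
  have fin: "finite (coord_index p)" using finite_mi_le by simp
  show ?thesis
  proof (rule constant_kernel_curve_or_injective[OF fin chart_open_range[OF UA] aU C1 dim_joint_kernel_eq[OF _ aU]])
    fix S assume S: "open S" "?a \<in> S" "S \<subseteq> \<phi> ` U"
      "\<And>x. x \<in> S \<Longrightarrow> (\<And>c. c \<in> coord_index p \<Longrightarrow> coords c x = coords c ?a) \<Longrightarrow> x = ?a"
    let ?S = "{x \<in> topspace (subtopology T U). \<phi> x \<in> S}"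
    have "openin (subtopology T U) ?S"
      using S(1) by (intro openin_continuous_map_preimage[OF chart_continuous[OF UA]]) simp
    then have "openin T ?S" using chart_open[OF UA] openin_trans_full by blast
    moreover have "K p \<inter> ?S = {\<one>}"
    proof
      show "{\<one>} \<subseteq> K p \<inter> ?S" using S(2) one one_K by (simp add: topspace_T)
      show "K p \<inter> ?S \<subseteq> {\<one>}"
      proof
        fix x assume x: "x \<in> K p \<inter> ?S"
        then have xU: "x \<in> U" and xK: "x \<in> K p" and xS: "\<phi> x \<in> S" by auto
        have eq: "coords c (\<phi> x) = coords c ?a" if c: "c \<in> coord_index p" for c
        proof -
          have v: "ps_var (fst c) \<in> PS n" using c by (auto intro: PS_var)
          then have "agree n p (\<rho> x (ps_var (fst c))) (\<rho> \<one> (ps_var (fst c)))"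
            using xK unfolding K_def by (simp add: rho_one)
          then show ?thesis
            unfolding chart_inv[OF UA xU] chart_inv[OF UA one] using c
            by (auto simp: agree_def mi_le_def)
        qed
        from S(4)[OF xS eq] have "\<phi> x = ?a" .
        from arg_cong[OF this, of "inv_into U \<phi>"] show "x \<in> {\<one>}"
          unfolding chart_inv[OF UA xU] chart_inv[OF UA one] unfolding singleton_iff .
      qed
    qed
    ultimately show ?thesis using p(1) by (intro exI[of _ p] conjI exI[of _ ?S])
  next
    fix \<gamma> \<gamma>' and \<epsilon> :: real
    assume \<gamma>: "\<epsilon> > 0" "\<gamma> 0 = ?a" "\<And>t. \<bar>t\<bar> < \<epsilon> \<Longrightarrow> \<gamma> t \<in> \<phi> ` U"
      "\<And>t. \<bar>t\<bar> < \<epsilon> \<Longrightarrow> (\<gamma> has_vector_derivative \<gamma>' t) (at t)"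
      "\<And>t. \<bar>t\<bar> < \<epsilon> \<Longrightarrow> \<gamma>' t \<in> ?J p (\<gamma> t)"
      "\<And>t. \<bar>t\<bar> < \<epsilon> \<Longrightarrow> t \<noteq> 0 \<Longrightarrow> \<gamma> t \<noteq> ?a"
    let ?t = "\<epsilon> / 2"
    have t: "\<bar>?t\<bar> < \<epsilon>" "?t \<noteq> 0" using \<gamma>(1) by auto
    have const: "coords c (\<gamma> ?t) = coords c ?a" if c: "c \<in> coord_index q" for c q
    proof -
      have "((\<lambda>t. coords c (\<gamma> t)) has_derivative (\<lambda>h. 0)) (at s within {-\<epsilon><..<\<epsilon>})"
        if "s \<in> {-\<epsilon><..<\<epsilon>}" for s
      proof -
        have s: "\<bar>s\<bar> < \<epsilon>" using that by auto
        let ?D = "frechet_derivative (coords c) (at (\<gamma> s))"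
        have D: "(coords c has_derivative ?D) (at (\<gamma> s))"
          using coords_differentiable[OF c \<gamma>(3)[OF s]] by (simp add: frechet_derivative_works)
        \<comment> \<open>The maximum is at least \<open>p\<close>, so the kernels have become
          stable, and at least \<open>q\<close>, so the coordinate \<open>c\<close> is among those
          considered.\<close>
        have "c \<in> coord_index (max p q)" using c by (auto simp: mi_le_def)
        moreover have "\<gamma>' s \<in> ?J (max p q) (\<gamma> s)"
          using \<gamma>(5)[OF s] stable[of "max p q", OF _ \<gamma>(3)[OF s]] by simp
        ultimately have "?D (\<gamma>' s) = 0" by (auto simp: joint_kernel_def)
        then have "(\<lambda>h. ?D (h *\<^sub>R \<gamma>' s)) = (\<lambda>h. 0)"
          using linear_scale[OF has_derivative_linear[OF D]] by simp
        moreover have "((\<lambda>t. coords c (\<gamma> t)) has_derivative (\<lambda>h. ?D (h *\<^sub>R \<gamma>' s))) (at s)"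
          using \<gamma>(4)[OF s] D unfolding has_vector_derivative_def by (rule has_derivative_compose)
        ultimately show ?thesis by (simp add: has_derivative_at_withinI)
      qed
      then obtain z where "\<forall>s\<in>{-\<epsilon><..<\<epsilon>}. coords c (\<gamma> s) = z"
        using has_derivative_zero_constant[of "{-\<epsilon><..<\<epsilon>}" "\<lambda>t. coords c (\<gamma> t)"] by auto
      then show ?thesis using \<gamma>(1,2) t by (metis abs_less_iff abs_zero greaterThanLessThan_iff minus_less_iff)
    qed
    let ?g = "inv_into U \<phi> (\<gamma> ?t)"
    have gU: "?g \<in> U" "\<phi> ?g = \<gamma> ?t" 
      using chart_inv_mem[OF UA \<gamma>(3)[OF t(1)]] chart_inv_right[OF UA \<gamma>(3)[OF t(1)]] .
    have "?g = \<one>"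
    proof (rule rho_eqI)
      show "?g \<in> carrier G" using gU chart_carrier[OF UA] by blast
      show "agree n q (\<rho> ?g (ps_var i)) (\<rho> \<one> (ps_var i))" if "i < n" for i q
        using const[of "(i, _)" q] that chart_inv[OF UA one] by (auto simp: agree_def mi_le_def)
    qed simp
    then have "\<gamma> ?t = ?a" using gU by simp
    then show ?thesis using \<gamma>(6)[OF t] by blast
  qed
qed

end

lemma kernel_discrete: "\<exists>p\<ge>1. \<exists>S. openin T S \<and> K p \<inter> S = {\<one>}"
proof -
  obtain U \<phi> where "(U, \<phi>) \<in> A" "\<one> \<in> U" by (rule chart_at[OF one_closed])
  then show ?thesis by (rule kernel_discrete_at_chart)
qed

end

subsection \<open>The kernels in the identity component\<close>

lemma (in group) commute_int_pow:
  assumes x: "x \<in> carrier G" and y: "y \<in> carrier G" and xy: "x \<otimes> y = y \<otimes> x"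
  shows "x \<otimes> y [^] (m::int) = y [^] m \<otimes> x"
proof (induction m rule: int_induct[of _ 0])
  case base then show ?case using x by simp
next
  case (step1 i)
  have "x \<otimes> y [^] (i + 1) = (x \<otimes> y [^] i) \<otimes> y" using x y by (simp add: int_pow_mult m_assoc)
  also have "\<dots> = y [^] i \<otimes> (x \<otimes> y)" unfolding step1(2) using x y by (simp add: m_assoc)
  also have "\<dots> = y [^] (i + 1) \<otimes> x" unfolding xy using x y by (simp add: int_pow_mult m_assoc)
  finally show ?case .
next
  case (step2 i)
  have i: "y [^] (i - 1) = y [^] i \<otimes> inv y" using y by (simp add: int_pow_diff)
  have "y \<otimes> (x \<otimes> inv y) = y \<otimes> x \<otimes> inv y" using x y by (simp add: m_assoc)
  also have "\<dots> = x" unfolding xy[symmetric] using x y by (simp add: m_assoc)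
  finally have "y \<otimes> (x \<otimes> inv y) = x" .
  then have inv: "x \<otimes> inv y = inv y \<otimes> x" using x y inv_solve_left[of "x \<otimes> inv y" y x] by simp
  have "x \<otimes> y [^] (i - 1) = (x \<otimes> y [^] i) \<otimes> inv y" unfolding i using x y by (simp add: m_assoc)
  also have "\<dots> = y [^] i \<otimes> (x \<otimes> inv y)" unfolding step2(2) using x y by (simp add: m_assoc)
  also have "\<dots> = y [^] (i - 1) \<otimes> x" unfolding inv i using x y by (simp add: m_assoc)
  finally show ?case .
qed

lemma (in group) int_pow_translation:
  fixes f :: "'a \<Rightarrow> real"
  assumes d: "d \<in> carrier G" and f: "\<And>g. g \<in> carrier G \<Longrightarrow> f (g \<otimes> d) = f g + c"
    and g: "g \<in> carrier G"
  shows "f (g \<otimes> d [^] (m::int)) = f g + of_int m * c"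
proof (induction m rule: int_induct[of _ 0])
  case base then show ?case using g by simp
next
  case (step1 i)
  have "g \<otimes> d [^] (i + 1) = (g \<otimes> d [^] i) \<otimes> d" using g d by (simp add: int_pow_mult m_assoc)
  then show ?case using f[of "g \<otimes> d [^] i"] step1 g d by (simp add: algebra_simps)
next
  case (step2 i)
  have "(g \<otimes> d [^] (i - 1)) \<otimes> d = g \<otimes> (d [^] (i - 1) \<otimes> d [^] (1::int))"
    using g d by (simp add: m_assoc)
  also have "\<dots> = g \<otimes> d [^] i" using d int_pow_mult[of d "i - 1" 1] by simp
  finally show ?case using f[of "g \<otimes> d [^] (i - 1)"] step2 g d by (simp add: algebra_simps)
qed

context group
begin

text \<open>The product of \<open>\<gamma> i (t i)\<close> for \<open>i < k\<close>, ordered from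
  left to right since the group need not be commutative.\<close>

primrec path_product :: "(nat \<Rightarrow> real \<Rightarrow> 'a) \<Rightarrow> nat \<Rightarrow> (nat \<Rightarrow> real) \<Rightarrow> 'a" where
  "path_product \<gamma> 0 t = \<one>"
| "path_product \<gamma> (Suc k) t = path_product \<gamma> k t \<otimes> \<gamma> k (t k)"

lemma path_product_closed: "(\<And>i s. \<gamma> i s \<in> carrier G) \<Longrightarrow> path_product \<gamma> k t \<in> carrier G"
  by (induction k) auto

lemma path_product_cong: "(\<And>i. i < k \<Longrightarrow> s i = t i) \<Longrightarrow> path_product \<gamma> k s = path_product \<gamma> k t"
  by (induction k) auto

text \<open>The power of \<open>d i\<close> produced in the factor with index \<open>i\<close> moves
  past all later factors, because \<open>d i\<close> commutes with every value of the paths.\<close>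

lemma path_product_shift:
  assumes \<gamma>: "\<And>i s. \<gamma> i s \<in> carrier G" and d: "\<And>i. d i \<in> carrier G"
    and shift: "\<And>i s m. \<gamma> i (s + of_int m) = \<gamma> i s \<otimes> d i [^] (m::int)"
    and commute: "\<And>i j s. \<gamma> i s \<otimes> d j = d j \<otimes> \<gamma> i s"
  shows "i < k \<Longrightarrow> path_product \<gamma> k (t(i := t i + of_int m)) = path_product \<gamma> k t \<otimes> d i [^] m"
proof (induction k)
  case (Suc k)
  note cl = path_product_closed[of \<gamma>, OF \<gamma>]
  show ?case
  proof (cases "i = k")
    case True
    have "path_product \<gamma> k (t(k := t k + of_int m)) = path_product \<gamma> k t"
      by (rule path_product_cong) simp
    then show ?thesis using True \<gamma> d cl by (simp add: shift m_assoc fun_upd_def)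
  next
    case False
    then have "path_product \<gamma> (Suc k) (t(i := t i + of_int m)) = (path_product \<gamma> k t \<otimes> d i [^] m) \<otimes> \<gamma> k (t k)"
      using Suc by (simp add: fun_upd_def)
    also have "\<dots> = path_product \<gamma> k t \<otimes> (\<gamma> k (t k) \<otimes> d i [^] m)"
      using commute_int_pow[OF \<gamma> d commute, of k "t k" i m] \<gamma> d cl by (simp add: m_assoc)
    also have "\<dots> = path_product \<gamma> (Suc k) t \<otimes> d i [^] m" using \<gamma> d cl by (simp add: m_assoc)
    finally show ?thesis .
  qed
qed simp

end

section \<open>Layers of the kernel filtration and the dimension bound\<close>

context charted_lie_rep
begin

text \<open>Some coefficient of degree \<open>q + 1\<close> distinguishes \<open>d\<close> from the
  unit. Normalised by \<open>layer_translation\<close>, it changes under right multiplication by an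
  element of \<open>K q\<close> by a constant depending on that element only. The condition
  \<open>q \<ge> 1\<close> makes elements of \<open>K q\<close> trivial on 1-jets.\<close>

lemma layer_function:
  assumes q: "q \<ge> 1" and d: "d \<in> K q" "d \<notin> K (Suc q)"
  obtains f :: "'g \<Rightarrow> real" where "dfun f"
    "\<And>g. g \<in> carrier G \<Longrightarrow> f (g \<otimes> d) = f g + 1"
    "\<And>g e. g \<in> carrier G \<Longrightarrow> e \<in> K (Suc q) \<Longrightarrow> f (g \<otimes> e) = f g + 0"
proof -
  have dG: "d \<in> carrier G" using d(1) by (rule K_carrier)
  obtain i where i: "i < n" "\<not> agree n (Suc q) (\<rho> d (ps_var i)) (ps_var i)"
    using K_from_vars[OF dG] d(2) by blast
  obtain \<alpha> where \<alpha>: "\<alpha> \<in> mi n" "mdeg n \<alpha> \<le> Suc q" "\<rho> d (ps_var i) \<alpha> \<noteq> ps_var i \<alpha>"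
    using i(2) by (auto simp: agree_def)
  have x: "ps_var i \<in> PS n" using i(1) by (rule PS_var)
  have "agree n q (\<rho> d (ps_var i)) (ps_var i)" using d(1) x by (simp add: K_def)
  then have deg: "mdeg n \<alpha> = Suc q" using \<alpha> by (auto simp: agree_def le_Suc_eq)
  define L where "L = (\<lambda>g. \<rho> (inv g) (ps_hom n (Suc q) (\<rho> g (ps_var i))) \<alpha>)"
  have L: "L (g \<otimes> e) = L g + (\<rho> e (ps_var i) \<alpha> - ps_var i \<alpha>)" if g: "g \<in> carrier G" and e: "e \<in> K q" for g e
  proof -
    have eG: "e \<in> carrier G" using e by (rule K_carrier)
    have "L (g \<otimes> e) = \<rho> (inv e) (\<rho> (inv g) (ps_hom n (Suc q) (\<rho> g (\<rho> e (ps_var i))))) \<alpha>"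
      using g eG by (simp add: L_def inv_mult_group rho_mult)
    also have "\<dots> = L g + (\<rho> e (ps_var i) \<alpha> - ps_var i \<alpha>)"
      unfolding L_def
    proof (rule layer_translation[of "\<rho> g" n "\<rho> (inv g)" "\<rho> e" "\<rho> (inv e)"])
      show "agree n 1 (\<rho> (inv e) f) f" if "f \<in> PS n" for f
        using K_inv[OF e] K_antimono[OF q] that unfolding K_def by blast
      show "agree n q (\<rho> e (ps_var i)) (ps_var i)" using e x unfolding K_def by blast
      show "\<rho> (inv g) (\<rho> g f) = f" if "f \<in> PS n" for f using rho_inv[OF g that] .
    qed (fact rho_Diff[OF g] rho_Diff[OF inv_closed[OF g]] rho_Diff[OF eG] rho_Diff[OF inv_closed[OF eG]]
        x \<alpha>(1) deg)+
    finally show ?thesis .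
  qed
  have "dfun (\<lambda>g. \<Sum>\<beta>\<in>mi_le n (Suc q). ps_hom n (Suc q) (\<rho> g (ps_var i)) \<beta> * \<rho> (inv g) (ps_mono \<beta>) \<alpha>)"
  proof (intro dfun_sum dfun_mult)
    fix \<beta> assume "\<beta> \<in> mi_le n (Suc q)"
    then have \<beta>: "\<beta> \<in> mi n" by (simp add: mi_le_def)
    show "dfun (\<lambda>g. \<rho> (inv g) (ps_mono \<beta>) \<alpha>)"
      by (rule dfun_inverse[OF dfun_coeff[OF PS_mono[OF \<beta>] \<alpha>(1)]])
    show "dfun (\<lambda>g. ps_hom n (Suc q) (\<rho> g (ps_var i)) \<beta>)"
    proof (cases "mdeg n \<beta> = Suc q")
      case True
      then show ?thesis using dfun_var[OF i(1) \<beta>] by (simp add: ps_hom_def)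
    next
      case False
      then show ?thesis using dfun_const by (simp add: ps_hom_def)
    qed
  qed
  then have dL: "dfun L"
  proof (rule dfun_cong)
    fix g assume g: "g \<in> carrier G"
    have "\<alpha> \<in> mi_le n (Suc q)" using \<alpha> by (simp add: mi_le_def)
    then show "(\<Sum>\<beta>\<in>mi_le n (Suc q). ps_hom n (Suc q) (\<rho> g (ps_var i)) \<beta> * \<rho> (inv g) (ps_mono \<beta>) \<alpha>) = L g"
      unfolding L_def using autom.coeff_expansion[OF autom_rho[OF inv_closed[OF g]] PS_hom[OF rho_PS[OF g x]]]
      by metis
  qed
  \<comment> \<open>The shift caused by \<open>d\<close>, nonzero by the choice of \<alpha>.
    Dividing by it normalises the shift to one, after which the real part may be taken.\<close>
  define c where "c = \<rho> d (ps_var i) \<alpha> - ps_var i \<alpha>"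
  have c: "c \<noteq> 0" using \<alpha>(3) by (simp add: c_def)
  show thesis
  proof (rule that[of "\<lambda>g. Re (L g / c)"])
    show "dfun (\<lambda>g. Re (L g / c))"
      by (rule dfun_linear[OF dL bounded_linear_compose[OF bounded_linear_Re bounded_linear_divide]])
    fix g assume g: "g \<in> carrier G"
    have "L (g \<otimes> d) / c = L g / c + 1" using L[OF g d(1)] c by (simp add: c_def[symmetric] add_divide_distrib)
    then show "Re (L (g \<otimes> d) / c) = Re (L g / c) + 1" by simp
    fix e assume e: "e \<in> K (Suc q)"
    then have "e \<in> K q" using K_antimono[of q "Suc q"] by auto
    moreover have "\<rho> e (ps_var i) \<alpha> = ps_var i \<alpha>" using e x \<alpha> by (auto simp: K_def agree_def)
    ultimately show "Re (L (g \<otimes> e) / c) = Re (L g / c) + 0" using L[OF g] by simp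
  qed
qed

text \<open>Since the kernels meet in the unit, a nontrivial element of a kernel leaves the
  filtration at a first level, and the level before that serves as \<open>q j\<close>. The next
  element is taken beyond this level. The bound \<open>max p 1\<close> serves discreteness and
  triviality on 1-jets.\<close>

lemma strict_layers:
  assumes ex: "\<And>q. q \<ge> 1 \<Longrightarrow> \<exists>g\<in>K q. connected_component_of T \<one> g \<and> g \<noteq> \<one>"
  shows "\<exists>(q :: nat \<Rightarrow> nat) (d :: nat \<Rightarrow> 'g).
    (\<forall>j. max p 1 \<le> q j \<and> connected_component_of T \<one> (d j) \<and> d j \<in> K (q j) \<and> d j \<notin> K (Suc (q j))) \<and>
    (\<forall>i j. i < j \<longrightarrow> d j \<in> K (Suc (q i)))"
proof -
  let ?P = "\<lambda>q d. max p 1 \<le> q \<and> connected_component_of T \<one> d \<and> d \<in> K q \<and> d \<notin> K (Suc q)"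
  have step: "\<exists>q d. q \<ge> m \<and> ?P q d" for m
  proof -
    define r where "r = max m (max p 1)"
    have "r \<ge> 1" by (simp add: r_def)
    then obtain g where g: "g \<in> K r" "connected_component_of T \<one> g" "g \<noteq> \<one>" using ex by blast
    obtain s where s: "g \<notin> K s" using Inter_K[of g] g(3) by blast
    define l where "l = (LEAST s. g \<notin> K s)"
    have l: "g \<notin> K l" unfolding l_def using s by (rule LeastI)
    have "r < l" using l g(1) K_antimono[of l r] by (meson not_less subsetD)
    then obtain l' where l': "l = Suc l'" "r \<le> l'" by (cases l) auto
    have "g \<in> K l'" using not_less_Least[of l' "\<lambda>s. g \<notin> K s"] l' by (auto simp: l_def[symmetric])
    then have "l' \<ge> m \<and> ?P l' g" using l l' g(2) by (auto simp: r_def)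
    then show ?thesis by blast
  qed
  have "\<exists>h. \<forall>j. ?P (fst (h j)) (snd (h j)) \<and> fst (h j) < fst (h (Suc j))"
  proof (rule dependent_nat_choice[where P = "\<lambda>_ x. ?P (fst x) (snd x)" and Q = "\<lambda>_ x y. fst x < fst y"])
    show "\<exists>x. ?P (fst x) (snd x)" using step[of 0] by auto
    show "\<exists>y. ?P (fst y) (snd y) \<and> fst x < fst y" for x :: "nat \<times> 'g"
      using step[of "Suc (fst x)"] by (metis Suc_le_lessD fst_conv snd_conv)
  qed
  then obtain h where h: "\<And>j. ?P (fst (h j)) (snd (h j))" "\<And>j. fst (h j) < fst (h (Suc j))" by blast
  have "snd (h j) \<in> K (Suc (fst (h i)))" if "i < j" for i j
  proof -
    have "fst (h i) < fst (h j)" using lift_Suc_mono_less[of "\<lambda>j. fst (h j)", OF h(2) that] .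
    then have "K (fst (h j)) \<subseteq> K (Suc (fst (h i)))" by (intro K_antimono) simp
    then show ?thesis using h(1)[of j] by blast
  qed
  then show ?thesis using h(1) by (intro exI[of _ "\<lambda>j. fst (h j)"] exI[of _ "\<lambda>j. snd (h j)"]) simp
qed

text \<open>Compactness reduces the claim to finitely many charts, in each of which a differentiable
  map goes into a space of larger dimension.\<close>

lemma dfun_image_negligible:
  fixes f :: "'g \<Rightarrow> 'v::euclidean_space"
  assumes f: "dfun f" and dim: "DIM('e) < DIM('v)" and S: "compactin T S"
  shows "negligible (f ` S)"
proof -
  have "S \<subseteq> \<Union>(fst ` A)"
    unfolding cover using compactin_subset_topspace[OF S] topspace_T by simp
  moreover have "openin T U" if "U \<in> fst ` A" for U using that chart_open by auto
  ultimately obtain \<F> where \<F>: "finite \<F>" "\<F> \<subseteq> fst ` A" "S \<subseteq> \<Union>\<F>"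
    using compactinD[OF S, of "fst ` A"] by blast
  have "negligible (f ` U)" if "U \<in> \<F>" for U
  proof -
    have "U \<in> fst ` A" using that \<F>(2) by blast
    then obtain \<phi> where U: "(U, \<phi>) \<in> A" by auto
    have "(\<lambda>a. f (inv_into U \<phi> a)) differentiable_on \<phi> ` U"
      using dfunD[OF f U] by (auto simp: differentiable_on_def intro: differentiable_at_withinI)
    then have "negligible ((\<lambda>a. f (inv_into U \<phi> a)) ` \<phi> ` U)"
      by (rule negligible_differentiable_image_lowdim[OF dim])
    moreover have "(\<lambda>a. f (inv_into U \<phi> a)) ` \<phi> ` U = f ` U"
      unfolding image_image using chart_inv[OF U] by (intro image_cong) auto
    ultimately show ?thesis by simp
  qed
  then have "negligible (\<Union>U\<in>\<F>. f ` U)" using \<F>(1) by (intro negligible_Union) auto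
  moreover have "f ` S \<subseteq> (\<Union>U\<in>\<F>. f ` U)" using \<F>(3) by blast
  ultimately show ?thesis by (rule negligible_subset)
qed

text \<open>The contradiction concerns \<open>h \<circ> F\<close> on
  \<open>'e \<times> real\<close>: quasi-periodicity gives it a compact set with non-negligible
  image, while its factorisation through \<open>G\<close> makes that image negligible.\<close>

lemma identity_component_kernel_trivial:
  "\<exists>q\<ge>1. \<forall>g\<in>K q. connected_component_of T \<one> g \<longrightarrow> g = \<one>"
proof (rule ccontr)
  assume "\<not> ?thesis"
  then have ex: "\<exists>g\<in>K q. connected_component_of T \<one> g \<and> g \<noteq> \<one>" if "q \<ge> 1" for q
    using that by blast
  obtain p S where p: "p \<ge> 1" "openin T S" "K p \<inter> S = {\<one>}" using kernel_discrete by blast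
  obtain q :: "nat \<Rightarrow> nat" and d :: "nat \<Rightarrow> 'g" where qd: "\<forall>j. max p 1 \<le> q j \<and> connected_component_of T \<one> (d j) \<and>
      d j \<in> K (q j) \<and> d j \<notin> K (Suc (q j))" and d4: "\<forall>i j. i < j \<longrightarrow> d j \<in> K (Suc (q i))"
    using strict_layers[of p, OF ex] by blast
  have q: "q j \<ge> p" "q j \<ge> 1" and d: "connected_component_of T \<one> (d j)" "d j \<in> K (q j)"
    "d j \<notin> K (Suc (q j))" for j
    using qd[rule_format, of j] by auto
  have dG: "d j \<in> carrier G" for j using d(2) K_carrier by blast
  \<comment> \<open>As \<open>q j \<ge> p\<close>, every \<open>d j\<close> lies in the discrete
    kernel \<open>K p\<close> and so centralises the identity component.\<close>
  have central: "g \<otimes> d j = d j \<otimes> g" if "connected_component_of T \<one> g" for g j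
  proof (rule discrete_kernel_central[OF p(2,3) _ that])
    show "d j \<in> K p" using d(2)[of j] K_antimono[OF q(1)[of j]] by blast
  qed
  have "\<exists>f. dfun f \<and> (\<forall>g\<in>carrier G. f (g \<otimes> d j) = f g + 1) \<and>
      (\<forall>g\<in>carrier G. \<forall>e\<in>K (Suc (q j)). f (g \<otimes> e) = f g + (0::real))" for j
    by (rule layer_function[OF q(2) d(2) d(3), of j]) blast
  then obtain f :: "nat \<Rightarrow> 'g \<Rightarrow> real" where f: "\<And>j. dfun (f j)"
    "\<And>j g. g \<in> carrier G \<Longrightarrow> f j (g \<otimes> d j) = f j g + 1"
    "\<And>j g e. g \<in> carrier G \<Longrightarrow> e \<in> K (Suc (q j)) \<Longrightarrow> f j (g \<otimes> e) = f j g + 0"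
    by metis
  have "\<exists>\<sigma>. pathin T \<sigma> \<and> \<sigma> 0 = \<one> \<and> \<sigma> 1 = d j" for j
  proof -
    have "d j \<in> connected_component_of_set T \<one>" using d(1) by simp
    then have "d j \<in> path_component_of_set T \<one>"
      by (simp only: path_component_eq_connected_component_of[OF locally_path_connected])
    then show ?thesis by (simp add: path_component_of_def)
  qed
  then obtain \<sigma> where \<sigma>: "\<And>j. pathin T (\<sigma> j)" "\<And>j. \<sigma> j 0 = \<one>" "\<And>j. \<sigma> j 1 = d j" by metis
  define \<gamma> where "\<gamma> = (\<lambda>j t. \<sigma> j (frac t) \<otimes> d j [^] \<lfloor>t\<rfloor>)"
  have \<gamma>: "continuous_map euclideanreal T (\<gamma> j)" for j
    unfolding \<gamma>_def by (rule quasiperiodic_path[OF \<sigma>])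
  have \<gamma>G: "\<gamma> j t \<in> carrier G" for j t using continuous_map_carrier[OF \<gamma>] by simp
  \<comment> \<open>The paths start at the unit and hence stay in the identity component, where the
    \<open>d j\<close> are central.\<close>
  have \<sigma>c: "connected_component_of T \<one> (\<sigma> j (frac t))" for j t
  proof -
    have "connectedin T (\<sigma> j ` {0..1})"
      using \<sigma>(1) path_connectedin_path_image path_connectedin_imp_connectedin by blast
    moreover have "\<one> \<in> \<sigma> j ` {0..1}" using \<sigma>(2)[of j] by (intro image_eqI[of _ _ 0]) auto
    moreover have "\<sigma> j (frac t) \<in> \<sigma> j ` {0..1}" using frac_lt_1[of t] by (intro imageI) (simp add: less_imp_le)
    ultimately show ?thesis unfolding connected_component_of_def by blast
  qed
  have \<sigma>G: "\<sigma> j (frac t) \<in> carrier G" for j t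
    using \<sigma>c connected_component_in_topspace topspace_T by metis
  have shift: "\<gamma> i (s + of_int m) = \<gamma> i s \<otimes> d i [^] (m::int)" for i s m
    using \<sigma>G dG by (simp add: \<gamma>_def frac_def int_pow_mult m_assoc flip: frac_def)
  have commute: "\<gamma> i s \<otimes> d j = d j \<otimes> \<gamma> i s" for i j s
  proof -
    have "d j \<otimes> d i [^] \<lfloor>s\<rfloor> = d i [^] \<lfloor>s\<rfloor> \<otimes> d j"
      using central[OF d(1), of j i] dG by (intro commute_int_pow) auto
    then show ?thesis
      using central[OF \<sigma>c, of i s j] \<sigma>G dG unfolding \<gamma>_def by (metis int_pow_closed m_assoc)
  qed
  \<comment> \<open>One parameter, and one layer, more than the dimension of the charts.\<close>
  define k where "k = DIM('e \<times> real)"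
  obtain b :: "nat \<Rightarrow> 'e \<times> real" where b: "bij_betw b {..<k} Basis"
    using ex_bij_betw_nat_finite[of "Basis :: ('e \<times> real) set"] by (auto simp: k_def atLeast0LessThan)
  have bB: "b i \<in> Basis" if "i < k" for i using b that by (auto simp: bij_betw_def)
  have inn: "b i \<bullet> b j = (if i = j then 1 else 0)" if "i < k" "j < k" for i j
    using b that bB by (auto simp: inner_Basis bij_betw_def inj_on_def)
  define F where "F = (\<lambda>v. path_product \<gamma> k (\<lambda>i. v \<bullet> b i))"
  have FG: "F v \<in> carrier G" for v unfolding F_def by (rule path_product_closed[OF \<gamma>G])
  have Fcont: "continuous_map euclidean T F"
  proof -
    have "continuous_map euclidean T (\<lambda>v. path_product \<gamma> m (\<lambda>i. v \<bullet> b i))" for m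
    proof (induction m)
      case 0 then show ?case by (simp add: topspace_T)
    next
      case (Suc m)
      have "continuous_map euclidean euclideanreal (\<lambda>v. v \<bullet> b m)"
        by (simp add: continuous_on_inner)
      from continuous_map_mult[OF Suc continuous_map_compose[OF this \<gamma>[of m]]]
      show ?case by (simp add: o_def)
    qed
    then show ?thesis by (simp add: F_def)
  qed
  have Fshift: "F (v + of_int m *\<^sub>R b i) = F v \<otimes> d i [^] m" if i: "i < k" for v m i
  proof -
    let ?t = "\<lambda>i. v \<bullet> b i"
    have "F (v + of_int m *\<^sub>R b i) = path_product \<gamma> k (?t(i := ?t i + of_int m))"
      unfolding F_def by (rule path_product_cong) (use i in \<open>auto simp: inner_add_left inn\<close>)
    also have "\<dots> = F v \<otimes> d i [^] m"
      unfolding F_def by (rule path_product_shift[OF \<gamma>G dG shift commute i])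
    finally show ?thesis .
  qed
  \<comment> \<open>The first \<open>k\<close> layer functions become the coordinates of a map to
    the same space on which \<open>F\<close> is defined.\<close>
  define h where "h = (\<lambda>g. \<Sum>j<k. f j g *\<^sub>R b j)"
  have h: "h g \<bullet> b j = f j g" if "j < k" for g j
  proof -
    have "h g \<bullet> b j = (\<Sum>i<k. if i = j then f i g else 0)"
      unfolding h_def inner_sum_left using that by (intro sum.cong) (auto simp: inn)
    then show ?thesis using that by simp
  qed
  have dh: "dfun h" unfolding h_def
    by (intro dfun_sum dfun_linear[OF f(1)] bounded_linear_scaleR_left)
  have "continuous_map euclidean euclidean (h \<circ> F)"
    using Fcont dfun_continuous[OF dh] by (rule continuous_map_compose)
  then have "continuous_on UNIV (h \<circ> F)" by simp
  \<comment> \<open>Triangularity: for \<open>i > j\<close> the element \<open>d i\<close> lies in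
    \<open>K (Suc (q j))\<close> and leaves \<open>f j\<close> unchanged, while \<open>d j\<close>
    shifts \<open>f j\<close> by one.\<close>
  moreover have "(h \<circ> F) (v + of_int m *\<^sub>R b i) \<bullet> b j = (h \<circ> F) v \<bullet> b j + (if i = j then of_int m else 0)"
    if "j \<le> i" "i < k" for i j v m
  proof -
    have j: "j < k" using that by simp
    have "f j (F v \<otimes> d i [^] m) = f j (F v) + of_int m * (if i = j then 1 else 0)"
    proof (rule int_pow_translation[OF dG _ FG])
      fix g assume g: "g \<in> carrier G"
      show "f j (g \<otimes> d i) = f j g + (if i = j then 1 else 0)"
        using f(2)[OF g] f(3)[OF g d4[rule_format, of j i]] that(1) by (cases "i = j") auto
    qed
    then show ?thesis using h[OF j] Fshift[OF that(2)] by simp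
  qed
  ultimately obtain S where S: "compact S" "\<not> negligible ((h \<circ> F) ` S)"
    using triangular_quasiperiodic_image_not_negligible[OF b, of "h \<circ> F"] by metis
  have "compactin T (F ` S)" using S(1) Fcont by (intro image_compactin[of euclidean]) auto
  then have "negligible (h ` F ` S)" using dfun_image_negligible[OF dh] by simp
  then show False using S(2) by (simp add: image_comp)
qed

end

section \<open>From the identity component to the whole group\<close>

context lie_rep
begin

text \<open>Two elements of \<open>K q\<close> in one component differ by an element of
  \<open>K q\<close> in the identity component, hence coincide. So \<open>K q\<close> is finite, and
  a single larger order excludes all its nontrivial elements.\<close>

lemma kernel_trivial:
  assumes fin: "finite (connected_components_of T)"
    and q: "\<And>g. g \<in> K q \<Longrightarrow> connected_component_of T \<one> g \<Longrightarrow> g = \<one>"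
  obtains p where "p \<ge> q" "K p = {\<one>}"
proof -
  have "inj_on (connected_component_of_set T) (K q)"
  proof (rule inj_onI)
    fix g h assume g: "g \<in> K q" and h: "h \<in> K q"
      and eq: "connected_component_of_set T g = connected_component_of_set T h"
    have "h \<in> connected_component_of_set T h"
      using h K_carrier topspace_T by (simp add: connected_component_of_refl)
    then have "connected_component_of T g h" using eq by blast
    then have "inv g \<otimes> h = \<one>" using q K_diff_K[OF g h] left_translate_component by blast
    then show "g = h" using inv_solve_left[of \<one> g h] K_carrier[OF g] K_carrier[OF h] by simp
  qed
  moreover have "connected_component_of_set T ` K q \<subseteq> connected_components_of T"
    using K_carrier topspace_T by (auto simp: connected_components_of_def)
  ultimately have finK: "finite (K q)" using fin inj_on_finite by blast
  have "\<exists>r. g \<notin> K r" if "g \<in> K q - {\<one>}" for g using Inter_K[of g] that by blast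
  then obtain r where r: "\<And>g. g \<in> K q - {\<one>} \<Longrightarrow> g \<notin> K (r g)" by metis
  \<comment> \<open>The sum over the finite kernel bounds every exclusion level \<open>r g\<close>,
    and the summand \<open>q\<close> keeps \<open>K p\<close> inside \<open>K q\<close>.\<close>
  define p where "p = q + (\<Sum>g\<in>K q. r g)"
  have "K p \<subseteq> {\<one>}"
  proof
    fix g assume g: "g \<in> K p"
    have gq: "g \<in> K q" using g K_antimono[of q p] by (auto simp: p_def)
    have "r g \<le> p" using member_le_sum[OF gq _ finK, of r] by (simp add: p_def)
    then have "g \<in> K (r g)" using g K_antimono by blast
    then show "g \<in> {\<one>}" using r gq by blast
  qed
  then show thesis using that[of p] one_K[of p] by (auto simp: p_def)
qed

end

theorem theorem2p5:
  fixes G :: "('g, 'm) monoid_scheme" and T :: "'g topology"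
    and A :: "('g set \<times> ('g \<Rightarrow> 'e::euclidean_space)) set"
    and n :: nat and \<rho> :: "'g \<Rightarrow> mser \<Rightarrow> mser"
  assumes "lie_group G T A"
    and "finite (connected_components_of T)"
    and "lie_hom_Diff G A n \<rho>"
    and "inj_on \<rho> (carrier G)"
  shows "\<exists>p::nat. \<forall>g1\<in>carrier G. \<forall>g2\<in>carrier G.
           jet n p (\<rho> g1) = jet n p (\<rho> g2) \<longleftrightarrow> g1 = g2"
proof -
  have "group G" using assms(1) by (simp add: lie_group_def)
  then interpret group G .
  interpret lie_rep G T A n \<rho> by standard (use assms in auto)
  have "\<exists>q\<ge>1. \<forall>g\<in>K q. connected_component_of T \<one>\<^bsub>G\<^esub> g \<longrightarrow> g = \<one>\<^bsub>G\<^esub>"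
  proof (cases "\<Union>(fst ` A) = carrier G")
    case True
    then interpret charted_lie_rep G T A n \<rho> by unfold_locales
    show ?thesis by (rule identity_component_kernel_trivial)
  next
    case False
    \<comment> \<open>Charts that do not cover the group leave only the discrete alternative, in
      which connected sets have at most one point.\<close>
    then have "T = discrete_topology (carrier G)" using assms(1) unfolding lie_group_def by argo
    then have "g = \<one>\<^bsub>G\<^esub>" if "connected_component_of T \<one>\<^bsub>G\<^esub> g" for g
      using that by (auto simp: connected_component_of_def connectedin_discrete_topology)
    then show ?thesis by blast
  qed
  then obtain q where q: "q \<ge> 1" "\<And>g. g \<in> K q \<Longrightarrow> connected_component_of T \<one>\<^bsub>G\<^esub> g \<Longrightarrow> g = \<one>\<^bsub>G\<^esub>" by blast
  obtain p where p: "p \<ge> q" "K p = {\<one>\<^bsub>G\<^esub>}" by (rule kernel_trivial[OF assms(2) q(2)])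
  then show ?thesis using jet_separates[OF p(2)] q(1) by (intro exI[of _ p]) auto
qed

end
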